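(* Let $m\ge 2$, $\varepsilon\in\{-1,0,1\}$, and let $M^m\hookrightarrow\mathbb{L}^m(\varepsilon)\times\mathbb{R}$ be a totally umbilical $c$-biharmonic hypersurface. Then $M^m$ is totally geodesic.
   Context: Space forms: $\mathbb{L}^n(\varepsilon)$ denotes the unit sphere $\mathbb{S}^n$, Euclidean space $\mathbb{R}^n$, or hyperbolic space $\mathbb{H}^n$, of constant sectional curvature $\varepsilon=1,0,-1$ respectively; $\mathbb{L}^m(\varepsilon)\times\mathbb{R}$ carries the product metric. A hypersurface $M^m$ is totally umbilical if its shape operator is $A=H\,\mathrm{Id}$, where $H=\mathrm{Tr}A/m$ is the mean curvature function, which is not assumed to be constant. Conventions: $R(X,Y)Z=[\nabla_X,\nabla_Y]Z-\nabla_{[X,Y]}Z$; $g(\mathrm{Ric}(X),Y)=\mathrm{Ric}(X,Y)=\mathrm{Tr}\{Z\mapsto R(Z,X)Y\}$; $\mathrm{Scal}=\mathrm{Tr}\,\mathrm{Ric}$; traces are taken with respect to the domain metric. $c$-biharmonic maps: for a smooth map $\phi:(M^m,g)\to(N^n,h)$ of Riemannian manifolds, let $\bar\nabla$ be the connection on $\phi^{-1}TN$, $\tau(\phi)=\mathrm{Tr}\,\bar\nabla d\phi$ the tension field, $\bar\Delta=-\mathrm{Tr}(\bar\nabla\bar\nabla-\bar\nabla_{\nabla})$ the rough Laplacian on $\phi^{-1}TN$, and $\tau_2(\phi)=-\bar\Delta\tau(\phi)-\mathrm{Tr}\,R^N(d\phi(\cdot),\tau(\phi))d\phi(\cdot)$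 the bitension field. The map $\phi$ is $c$-biharmonic (conformal-biharmonic) if $$\tau_2^c(\phi):=\tau_2(\phi)-\tfrac23\,\mathrm{Scal}\,\tau(\phi)+2\,\mathrm{Tr}(\bar\nabla d\phi)(\mathrm{Ric}(\cdot),\cdot)+\tfrac13 d\phi(\nabla\mathrm{Scal})=0,$$ where $\mathrm{Scal}$ and $\mathrm{Ric}$ are those of $(M,g)$. A $c$-biharmonic hypersurface is a codimension-one isometric immersion that is a $c$-biharmonic map. All hypersurfaces are oriented and without boundary. *)

theory Defs
  imports "HOL-Analysis.Analysis"
begin

abbreviation dir_deriv :: "('a::real_normed_vector \<Rightarrow> 'b::real_normed_vector) \<Rightarrow> 'a \<Rightarrow> 'a \<Rightarrow> 'b"
  where "dir_deriv f x u \<equiv> frechet_derivative f (at x) u"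

primrec Ck_on :: "nat \<Rightarrow> 'a::euclidean_space set \<Rightarrow> ('a \<Rightarrow> 'b::real_normed_vector) \<Rightarrow> bool" where
  "Ck_on 0 S f \<longleftrightarrow> continuous_on S f"
| "Ck_on (Suc k) S f \<longleftrightarrow>
     (\<forall>x\<in>S. f differentiable (at x)) \<and> (\<forall>u. Ck_on k S (\<lambda>x. dir_deriv f x u))"

definition smooth_on :: "'a::euclidean_space set \<Rightarrow> ('a \<Rightarrow> 'b::real_normed_vector) \<Rightarrow> bool"
  where "smooth_on S f \<longleftrightarrow> (\<forall>k. Ck_on k S f)"

text \<open>
  A chart is a pair of a domain and a coordinate map.  Tensors are given by their components in
  charts: \<open>metric M c x u v\<close> is the value of the metric on the vectors with components \<open>u\<close>, \<open>v\<close>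
  at the point whose coordinates in the chart \<open>c\<close> are \<open>x\<close>.  The dimension is \<open>DIM('a)\<close>.
\<close>

type_synonym ('p, 'a) chart = "'p set \<times> ('p \<Rightarrow> 'a)"

abbreviation chart_dom :: "('p, 'a) chart \<Rightarrow> 'p set" where "chart_dom \<equiv> fst"
abbreviation chart_map :: "('p, 'a) chart \<Rightarrow> 'p \<Rightarrow> 'a" where "chart_map \<equiv> snd"

definition chart_inv :: "('p, 'a) chart \<Rightarrow> 'a \<Rightarrow> 'p"
  where "chart_inv c = inv_into (chart_dom c) (chart_map c)"

record ('p, 'a) rmanifold =
  mtop :: "'p topology"
  atlas :: "('p, 'a) chart set"
  metric :: "('p, 'a) chart \<Rightarrow> 'a \<Rightarrow> 'a \<Rightarrow> 'a \<Rightarrow> real"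

definition transition :: "('p, 'a) chart \<Rightarrow> ('p, 'a) chart \<Rightarrow> 'a \<Rightarrow> 'a"
  where "transition c c' = chart_map c' \<circ> chart_inv c"

definition smooth_manifold :: "('p, 'a::euclidean_space) rmanifold \<Rightarrow> bool" where
  "smooth_manifold M \<longleftrightarrow>
     Hausdorff_space (mtop M) \<and> second_countable (mtop M) \<and>
     (\<Union>c\<in>atlas M. chart_dom c) = topspace (mtop M) \<and>
     (\<forall>c\<in>atlas M. openin (mtop M) (chart_dom c) \<and> open (chart_map c ` chart_dom c) \<and>
        homeomorphic_map (subtopology (mtop M) (chart_dom c))
          (top_of_set (chart_map c ` chart_dom c)) (chart_map c)) \<and>
     (\<forall>c\<in>atlas M. \<forall>c'\<in>atlas M.
        smooth_on (chart_map c ` (chart_dom c \<inter> chart_dom c')) (transition c c'))"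

definition riemannian_manifold :: "('p, 'a::euclidean_space) rmanifold \<Rightarrow> bool" where
  "riemannian_manifold M \<longleftrightarrow> smooth_manifold M \<and>
     (\<forall>c\<in>atlas M.
        (\<forall>u v. smooth_on (chart_map c ` chart_dom c) (\<lambda>x. metric M c x u v)) \<and>
        (\<forall>x \<in> chart_map c ` chart_dom c.
           bilinear (metric M c x) \<and>
           (\<forall>u v. metric M c x u v = metric M c x v u) \<and>
           (\<forall>u. u \<noteq> 0 \<longrightarrow> metric M c x u u > 0))) \<and>
     (\<forall>c\<in>atlas M. \<forall>c'\<in>atlas M. \<forall>x \<in> chart_map c ` (chart_dom c \<inter> chart_dom c'). \<forall>u v.
        metric M c x u v =
        metric M c' (transition c c' x)
          (dir_deriv (transition c c') x u) (dir_deriv (transition c c') x v))"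

text \<open>
  Below, \<open>G x u v\<close> is a metric on an open set of coordinates, and fixed vectors
  \<open>u\<close>, \<open>v\<close>, \<open>w\<close> stand for the coordinate vector fields with these constant components;
  such fields commute.
\<close>

definition sharp :: "('a \<Rightarrow> 'a \<Rightarrow> real) \<Rightarrow> ('a \<Rightarrow> real) \<Rightarrow> 'a"
  where "sharp g \<alpha> = (THE z. \<forall>w. g z w = \<alpha> w)"

text \<open>
  The vector \<open>sharp g (\<lambda>w. w \<bullet> i)\<close> is the \<open>i\<close>-th row of the inverse Gram matrix, so the
  following is the contraction of \<open>b\<close> with the inverse metric.
\<close>

definition metric_trace ::
    "('a::euclidean_space \<Rightarrow> 'a \<Rightarrow> real) \<Rightarrow> ('a \<Rightarrow> 'a \<Rightarrow> 'b::real_vector) \<Rightarrow> 'b"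
  where "metric_trace g b = (\<Sum>i\<in>Basis. b i (sharp g (\<lambda>w. w \<bullet> i)))"

definition op_trace :: "('a::euclidean_space \<Rightarrow> 'a) \<Rightarrow> real"
  where "op_trace L = (\<Sum>i\<in>Basis. L i \<bullet> i)"

text \<open>The Koszul formula for coordinate vector fields: \<open>christoffel G x u v = \<nabla>\<^sub>u v\<close>.\<close>

definition christoffel :: "('a::euclidean_space \<Rightarrow> 'a \<Rightarrow> 'a \<Rightarrow> real) \<Rightarrow> 'a \<Rightarrow> 'a \<Rightarrow> 'a \<Rightarrow> 'a" where
  "christoffel G x u v = sharp (G x) (\<lambda>w.
     (dir_deriv (\<lambda>y. G y v w) x u + dir_deriv (\<lambda>y. G y u w) x v - dir_deriv (\<lambda>y. G y u v) x w) / 2)"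

definition cov_deriv :: "('a::euclidean_space \<Rightarrow> 'a \<Rightarrow> 'a \<Rightarrow> real) \<Rightarrow> ('a \<Rightarrow> 'a) \<Rightarrow> 'a \<Rightarrow> 'a \<Rightarrow> 'a"
  where "cov_deriv G Y x u = dir_deriv Y x u + christoffel G x u (Y x)"

definition curvature ::
    "('a::euclidean_space \<Rightarrow> 'a \<Rightarrow> 'a \<Rightarrow> real) \<Rightarrow> 'a \<Rightarrow> 'a \<Rightarrow> 'a \<Rightarrow> 'a \<Rightarrow> 'a" where
  "curvature G x u v w =
     cov_deriv G (\<lambda>y. cov_deriv G (\<lambda>_. w) y v) x u - cov_deriv G (\<lambda>y. cov_deriv G (\<lambda>_. w) y u) x v"

definition ricci :: "('a::euclidean_space \<Rightarrow> 'a \<Rightarrow> 'a \<Rightarrow> real) \<Rightarrow> 'a \<Rightarrow> 'a \<Rightarrow> 'a \<Rightarrow> real"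
  where "ricci G x u v = op_trace (\<lambda>z. curvature G x z u v)"

definition ricci_op :: "('a::euclidean_space \<Rightarrow> 'a \<Rightarrow> 'a \<Rightarrow> real) \<Rightarrow> 'a \<Rightarrow> 'a \<Rightarrow> 'a"
  where "ricci_op G x u = sharp (G x) (ricci G x u)"

definition scal :: "('a::euclidean_space \<Rightarrow> 'a \<Rightarrow> 'a \<Rightarrow> real) \<Rightarrow> 'a \<Rightarrow> real"
  where "scal G x = op_trace (ricci_op G x)"

definition gradient :: "('a::euclidean_space \<Rightarrow> 'a \<Rightarrow> 'a \<Rightarrow> real) \<Rightarrow> ('a \<Rightarrow> real) \<Rightarrow> 'a \<Rightarrow> 'a"
  where "gradient G h x = sharp (G x) (dir_deriv h x)"

text \<open>
  \<open>f\<close> is the expression of a map in charts, \<open>G\<close> and \<open>H\<close> are the metrics of its domain and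
  target in these charts, and \<open>V\<close> holds the components of a section of the pull-back of the
  tangent bundle of the target.
\<close>

definition pull_cov ::
    "('b::euclidean_space \<Rightarrow> 'b \<Rightarrow> 'b \<Rightarrow> real) \<Rightarrow> ('a::euclidean_space \<Rightarrow> 'b) \<Rightarrow>
     ('a \<Rightarrow> 'b) \<Rightarrow> 'a \<Rightarrow> 'a \<Rightarrow> 'b"
  where "pull_cov H f V x u = dir_deriv V x u + christoffel H (f x) (dir_deriv f x u) (V x)"

definition second_fform ::
    "('a::euclidean_space \<Rightarrow> 'a \<Rightarrow> 'a \<Rightarrow> real) \<Rightarrow> ('b::euclidean_space \<Rightarrow> 'b \<Rightarrow> 'b \<Rightarrow> real) \<Rightarrow>
     ('a \<Rightarrow> 'b) \<Rightarrow> 'a \<Rightarrow> 'a \<Rightarrow> 'a \<Rightarrow> 'b" where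
  "second_fform G H f x u v =
     pull_cov H f (\<lambda>y. dir_deriv f y v) x u - dir_deriv f x (cov_deriv G (\<lambda>_. v) x u)"

definition tension ::
    "('a::euclidean_space \<Rightarrow> 'a \<Rightarrow> 'a \<Rightarrow> real) \<Rightarrow> ('b::euclidean_space \<Rightarrow> 'b \<Rightarrow> 'b \<Rightarrow> real) \<Rightarrow>
     ('a \<Rightarrow> 'b) \<Rightarrow> 'a \<Rightarrow> 'b"
  where "tension G H f x = metric_trace (G x) (second_fform G H f x)"

definition rough_laplacian ::
    "('a::euclidean_space \<Rightarrow> 'a \<Rightarrow> 'a \<Rightarrow> real) \<Rightarrow> ('b::euclidean_space \<Rightarrow> 'b \<Rightarrow> 'b \<Rightarrow> real) \<Rightarrow>
     ('a \<Rightarrow> 'b) \<Rightarrow> ('a \<Rightarrow> 'b) \<Rightarrow> 'a \<Rightarrow> 'b" where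
  "rough_laplacian G H f V x = - metric_trace (G x) (\<lambda>u v.
     pull_cov H f (\<lambda>y. pull_cov H f V y v) x u - pull_cov H f V x (cov_deriv G (\<lambda>_. v) x u))"

definition bitension ::
    "('a::euclidean_space \<Rightarrow> 'a \<Rightarrow> 'a \<Rightarrow> real) \<Rightarrow> ('b::euclidean_space \<Rightarrow> 'b \<Rightarrow> 'b \<Rightarrow> real) \<Rightarrow>
     ('a \<Rightarrow> 'b) \<Rightarrow> 'a \<Rightarrow> 'b" where
  "bitension G H f x =
     - rough_laplacian G H f (tension G H f) x
     - metric_trace (G x) (\<lambda>u v.
         curvature H (f x) (dir_deriv f x u) (tension G H f x) (dir_deriv f x v))"

definition conformal_bitension ::
    "('a::euclidean_space \<Rightarrow> 'a \<Rightarrow> 'a \<Rightarrow> real) \<Rightarrow> ('b::euclidean_space \<Rightarrow> 'b \<Rightarrow> 'b \<Rightarrow> real) \<Rightarrow>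
     ('a \<Rightarrow> 'b) \<Rightarrow> 'a \<Rightarrow> 'b" where
  "conformal_bitension G H f x =
     bitension G H f x
     - (2 / 3 * scal G x) *\<^sub>R tension G H f x
     + 2 *\<^sub>R metric_trace (G x) (\<lambda>u v. second_fform G H f x (ricci_op G x u) v)
     + (1 / 3) *\<^sub>R dir_deriv f x (gradient G (scal G) x)"

definition local_rep ::
    "('p, 'a) chart \<Rightarrow> ('q, 'b) chart \<Rightarrow> ('p \<Rightarrow> 'q) \<Rightarrow> 'a \<Rightarrow> 'b"
  where "local_rep c d \<phi> = chart_map d \<circ> \<phi> \<circ> chart_inv c"

definition local_dom :: "('p, 'a) chart \<Rightarrow> ('q, 'b) chart \<Rightarrow> ('p \<Rightarrow> 'q) \<Rightarrow> 'a set"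
  where "local_dom c d \<phi> = chart_map c ` {p \<in> chart_dom c. \<phi> p \<in> chart_dom d}"

definition smooth_map ::
    "('p, 'a::euclidean_space) rmanifold \<Rightarrow> ('q, 'b::euclidean_space) rmanifold \<Rightarrow>
     ('p \<Rightarrow> 'q) \<Rightarrow> bool" where
  "smooth_map M N \<phi> \<longleftrightarrow> continuous_map (mtop M) (mtop N) \<phi> \<and>
     (\<forall>c\<in>atlas M. \<forall>d\<in>atlas N. smooth_on (local_dom c d \<phi>) (local_rep c d \<phi>))"

definition c_biharmonic ::
    "('p, 'a::euclidean_space) rmanifold \<Rightarrow> ('q, 'b::euclidean_space) rmanifold \<Rightarrow>
     ('p \<Rightarrow> 'q) \<Rightarrow> bool" where
  "c_biharmonic M N \<phi> \<longleftrightarrow> smooth_map M N \<phi> \<and>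
     (\<forall>c\<in>atlas M. \<forall>d\<in>atlas N. \<forall>x\<in>local_dom c d \<phi>.
        conformal_bitension (metric M c) (metric N d) (local_rep c d \<phi>) x = 0)"

definition isometric_immersion ::
    "('p, 'a::euclidean_space) rmanifold \<Rightarrow> ('q, 'b::euclidean_space) rmanifold \<Rightarrow>
     ('p \<Rightarrow> 'q) \<Rightarrow> bool" where
  "isometric_immersion M N \<phi> \<longleftrightarrow> smooth_map M N \<phi> \<and>
     (\<forall>c\<in>atlas M. \<forall>d\<in>atlas N. \<forall>x\<in>local_dom c d \<phi>.
        inj (dir_deriv (local_rep c d \<phi>) x) \<and>
        (\<forall>u v. metric M c x u v =
           metric N d (local_rep c d \<phi> x)
             (dir_deriv (local_rep c d \<phi>) x u) (dir_deriv (local_rep c d \<phi>) x v)))"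

text \<open>
  A section of the pull-back of the tangent bundle of \<open>N\<close> is given by its components:
  \<open>\<eta> d p\<close> are the components, in the chart \<open>d\<close> of \<open>N\<close> around \<open>\<phi> p\<close>, of the vector at \<open>p\<close>.
\<close>

definition section_along ::
    "('p, 'a::euclidean_space) rmanifold \<Rightarrow> ('q, 'b::euclidean_space) rmanifold \<Rightarrow>
     ('p \<Rightarrow> 'q) \<Rightarrow> (('q, 'b) chart \<Rightarrow> 'p \<Rightarrow> 'b) \<Rightarrow> bool" where
  "section_along M N \<phi> \<eta> \<longleftrightarrow>
     (\<forall>d\<in>atlas N. \<forall>d'\<in>atlas N. \<forall>p\<in>topspace (mtop M). \<phi> p \<in> chart_dom d \<inter> chart_dom d' \<longrightarrow>
        \<eta> d' p = dir_deriv (transition d d') (chart_map d (\<phi> p)) (\<eta> d p)) \<and>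
     (\<forall>c\<in>atlas M. \<forall>d\<in>atlas N. smooth_on (local_dom c d \<phi>) (\<eta> d \<circ> chart_inv c))"

definition unit_normal_field ::
    "('p, 'a::euclidean_space) rmanifold \<Rightarrow> ('q, 'b::euclidean_space) rmanifold \<Rightarrow>
     ('p \<Rightarrow> 'q) \<Rightarrow> (('q, 'b) chart \<Rightarrow> 'p \<Rightarrow> 'b) \<Rightarrow> bool" where
  "unit_normal_field M N \<phi> \<eta> \<longleftrightarrow> section_along M N \<phi> \<eta> \<and>
     (\<forall>c\<in>atlas M. \<forall>d\<in>atlas N. \<forall>x\<in>local_dom c d \<phi>.
        let h = metric N d (local_rep c d \<phi> x); n = \<eta> d (chart_inv c x) in
        h n n = 1 \<and> (\<forall>u. h n (dir_deriv (local_rep c d \<phi>) x u) = 0))"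

definition oriented_hypersurface ::
    "('p, 'a::euclidean_space) rmanifold \<Rightarrow> ('q, 'b::euclidean_space) rmanifold \<Rightarrow>
     ('p \<Rightarrow> 'q) \<Rightarrow> (('q, 'b) chart \<Rightarrow> 'p \<Rightarrow> 'b) \<Rightarrow> bool" where
  "oriented_hypersurface M N \<phi> \<eta> \<longleftrightarrow>
     riemannian_manifold M \<and> DIM('b) = DIM('a) + 1 \<and>
     isometric_immersion M N \<phi> \<and> unit_normal_field M N \<phi> \<eta>"

text \<open>
  The shape operator sends \<open>u\<close> to the tangential part of minus the covariant derivative of the
  unit normal, that is, \<open>g(A u, v) = - h(\<nabla>\<^sub>u \<eta>, d\<phi> v)\<close>.
\<close>

definition shape_operator ::
    "('p, 'a::euclidean_space) rmanifold \<Rightarrow> ('q, 'b::euclidean_space) rmanifold \<Rightarrow>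
     ('p \<Rightarrow> 'q) \<Rightarrow> (('q, 'b) chart \<Rightarrow> 'p \<Rightarrow> 'b) \<Rightarrow>
     ('p, 'a) chart \<Rightarrow> ('q, 'b) chart \<Rightarrow> 'a \<Rightarrow> 'a \<Rightarrow> 'a" where
  "shape_operator M N \<phi> \<eta> c d x u =
     (let f = local_rep c d \<phi> in
      sharp (metric M c x) (\<lambda>v.
        - metric N d (f x) (pull_cov (metric N d) f (\<eta> d \<circ> chart_inv c) x u) (dir_deriv f x v)))"

definition mean_curvature ::
    "('p, 'a::euclidean_space) rmanifold \<Rightarrow> ('q, 'b::euclidean_space) rmanifold \<Rightarrow>
     ('p \<Rightarrow> 'q) \<Rightarrow> (('q, 'b) chart \<Rightarrow> 'p \<Rightarrow> 'b) \<Rightarrow>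
     ('p, 'a) chart \<Rightarrow> ('q, 'b) chart \<Rightarrow> 'a \<Rightarrow> real" where
  "mean_curvature M N \<phi> \<eta> c d x = op_trace (shape_operator M N \<phi> \<eta> c d x) / real DIM('a)"

definition totally_umbilical ::
    "('p, 'a::euclidean_space) rmanifold \<Rightarrow> ('q, 'b::euclidean_space) rmanifold \<Rightarrow>
     ('p \<Rightarrow> 'q) \<Rightarrow> (('q, 'b) chart \<Rightarrow> 'p \<Rightarrow> 'b) \<Rightarrow> bool" where
  "totally_umbilical M N \<phi> \<eta> \<longleftrightarrow>
     (\<forall>c\<in>atlas M. \<forall>d\<in>atlas N. \<forall>x\<in>local_dom c d \<phi>. \<forall>u.
        shape_operator M N \<phi> \<eta> c d x u = mean_curvature M N \<phi> \<eta> c d x *\<^sub>R u)"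

definition totally_geodesic ::
    "('p, 'a::euclidean_space) rmanifold \<Rightarrow> ('q, 'b::euclidean_space) rmanifold \<Rightarrow>
     ('p \<Rightarrow> 'q) \<Rightarrow> bool" where
  "totally_geodesic M N \<phi> \<longleftrightarrow>
     (\<forall>c\<in>atlas M. \<forall>d\<in>atlas N. \<forall>x\<in>local_dom c d \<phi>. \<forall>u v.
        second_fform (metric M c) (metric N d) (local_rep c d \<phi>) x u v = 0)"

text \<open>
  A submanifold \<open>S\<close> of a vector space with a symmetric bilinear form \<open>\<beta>\<close> (possibly indefinite,
  but positive definite on the tangent spaces of \<open>S\<close>), with the induced metric.  The atlas is the
  maximal one, consisting of the inverses of all regular smooth parametrisations of open
  subsets of \<open>S\<close>; the parameter space \<open>'b\<close> has to have the dimension of \<open>S\<close>.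
\<close>

definition submanifold ::
    "('e::euclidean_space \<Rightarrow> 'e \<Rightarrow> real) \<Rightarrow> 'e set \<Rightarrow> ('e, 'b::euclidean_space) rmanifold" where
  "submanifold \<beta> S =
     \<lparr> mtop = top_of_set S,
       atlas = {d. openin (top_of_set S) (chart_dom d) \<and> open (chart_map d ` chart_dom d) \<and>
         homeomorphism (chart_dom d) (chart_map d ` chart_dom d) (chart_map d) (chart_inv d) \<and>
         smooth_on (chart_map d ` chart_dom d) (chart_inv d) \<and>
         (\<forall>y \<in> chart_map d ` chart_dom d. inj (dir_deriv (chart_inv d) y))},
       metric = (\<lambda>d y u v. \<beta> (dir_deriv (chart_inv d) y u) (dir_deriv (chart_inv d) y v)) \<rparr>"

text \<open>
  The models of the space forms in \<open>\<real>\<^sup>m \<times> \<real>\<close>: the unit sphere, the hyperplane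
  \<open>\<real>\<^sup>m \<times> {0}\<close>, and the upper sheet of the hyperboloid in Minkowski space.
\<close>

definition space_form :: "real \<Rightarrow> ('a::euclidean_space \<times> real) set" where
  "space_form \<epsilon> =
     (if \<epsilon> = 1 then sphere 0 1
      else if \<epsilon> = 0 then UNIV \<times> {0}
      else {(x, t). x \<bullet> x - t\<^sup>2 = - 1 \<and> t > 0})"

definition space_form_ambient :: "real \<Rightarrow> 'a::euclidean_space \<times> real \<Rightarrow> 'a \<times> real \<Rightarrow> real" where
  "space_form_ambient \<epsilon> v w =
     (if \<epsilon> = - 1 then fst v \<bullet> fst w - snd v * snd w else v \<bullet> w)"

definition space_form_times_line ::
    "real \<Rightarrow> (('a::euclidean_space \<times> real) \<times> real, 'a \<times> real) rmanifold" where
  "space_form_times_line \<epsilon> =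
     submanifold (\<lambda>v w. space_form_ambient \<epsilon> (fst v) (fst w) + snd v * snd w)
       (space_form \<epsilon> \<times> UNIV)"

end

theory Submission
  imports Defs
begin

text \<open>
  Let \<open>T\<close> be the tangential part of the unit vertical field and \<open>\<theta>\<close> the component along the unit normal,
  so that \<open>|T|\<^sup>2 = 1 - \<theta>\<^sup>2\<close>.  For an umbilical hypersurface \<open>\<nabla>\<theta> = - H T\<close>, and the Codazzi equation
  gives \<open>\<nabla>H = - \<epsilon> \<theta> T\<close>; by the Gauss equation \<open>Ric\<close> and \<open>Scal\<close> are polynomials in \<open>H\<close>, \<open>\<theta>\<close>, \<open>T\<close>.
  The tangential part of the \<open>c\<close>-biharmonic equation then reads
  \<open>(5 m\<^sup>2 - 10 m - 4) \<epsilon> \<theta> H T = 0\<close>, and its coefficient has no integral root.  If \<open>\<epsilon> \<noteq> 0\<close> and \<open>H \<noteq> 0\<close>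
  somewhere, then \<open>\<theta> T\<close> vanishes nearby, and differentiating it forces \<open>T \<otimes> T = \<theta>\<^sup>2 g\<close>, which is
  impossible for \<open>m \<ge> 2\<close>.  If \<open>\<epsilon> = 0\<close>, then \<open>H\<close> is locally constant and the normal part of the
  equation is \<open>(2 m\<^sup>2 - 5 m + 6) H\<^sup>3 = 0\<close>.  All covariant derivatives are computed by pushing vectors
  forward to the flat space that contains the model of the space form.
\<close>

section \<open>Calculus of smooth functions\<close>

text \<open>The notions are given in coordinates and through definite descriptions
  (\<open>sharp\<close>), so the regularity of Christoffel symbols and of H has to be derived; for H
  it comes out of the umbilical condition itself. Viewing both the product space and M as patches of
  one flat space reduces every curvature to the same Gauss equation, and keeping a factor \<epsilon>
  in front of the position vector treats the three models at once. The bound m \<ge> 2 enters twice: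
  a one-form a with a(u) w = a(w) u vanishes, which gives Codazzi; and T \<otimes> T has a nonzero
  kernel vector, so T \<otimes> T = \<theta>^2 g yields \<theta> = 0, then T = 0, against |T|^2 = 1
  - \<theta>^2. The tangential part of the equation serves the case \<epsilon> \<noteq> 0 and the
  normal part the case \<epsilon> = 0, hence the normal part of the rough Laplacian is recorded only
  modulo \<epsilon>.\<close>

lemma dir_deriv_eq: "(f has_derivative D) (at x) \<Longrightarrow> dir_deriv f x u = D u"
  using frechet_derivative_at by metis

lemma has_derivative_cong_open:
  assumes "open S" "x \<in> S" "\<And>y. y \<in> S \<Longrightarrow> f y = g y"
  shows "(f has_derivative D) (at x) \<longleftrightarrow> (g has_derivative D) (at x)"
proof
  assume "(f has_derivative D) (at x)"
  then show "(g has_derivative D) (at x)"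
    by (rule has_derivative_transform_within_open[OF _ assms])
next
  assume "(g has_derivative D) (at x)"
  then show "(f has_derivative D) (at x)"
    by (rule has_derivative_transform_within_open[OF _ assms(1,2) assms(3)[symmetric]])
qed

lemma frechet_derivative_cong_open:
  assumes "open S" "x \<in> S" "\<And>y. y \<in> S \<Longrightarrow> f y = g y"
  shows "frechet_derivative f (at x) = frechet_derivative g (at x)"
  by (simp add: frechet_derivative_def has_derivative_cong_open[OF assms])

lemma differentiable_cong_open:
  assumes "open S" "x \<in> S" "\<And>y. y \<in> S \<Longrightarrow> f y = g y"
  shows "f differentiable (at x) \<longleftrightarrow> g differentiable (at x)"
  by (simp add: differentiable_def has_derivative_cong_open[OF assms])

lemma has_derivative_dir_deriv:
  "f differentiable (at x) \<Longrightarrow> (f has_derivative dir_deriv f x) (at x)"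
  using frechet_derivative_works by blast

lemma linear_dir_deriv: "f differentiable (at x) \<Longrightarrow> linear (dir_deriv f x)"
  by (rule linear_frechet_derivative)

lemma linear_basis_expansion:
  fixes L :: "'a::euclidean_space \<Rightarrow> 'b::real_vector"
  assumes "linear L"
  shows "L u = (\<Sum>i\<in>Basis. (u \<bullet> i) *\<^sub>R L i)"
proof -
  have "L u = L (\<Sum>i\<in>Basis. (u \<bullet> i) *\<^sub>R i)" by (simp add: euclidean_representation)
  also have "\<dots> = (\<Sum>i\<in>Basis. (u \<bullet> i) *\<^sub>R L i)"
    by (simp add: linear_sum[OF assms] linear_cmul[OF assms])
  finally show ?thesis .
qed

text \<open>Openness matters because \<open>Ck_on\<close> takes derivatives in the full space, which
  depend on the function in a whole neighbourhood.\<close>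

lemma Ck_on_cong:
  assumes "open S" "\<And>y. y \<in> S \<Longrightarrow> f y = g y"
  shows "Ck_on k S f \<longleftrightarrow> Ck_on k S g"
  using assms(2)
proof (induction k arbitrary: f g)
  case 0
  then show ?case by (auto intro: continuous_on_cong)
next
  case (Suc k)
  have D: "frechet_derivative f (at x) = frechet_derivative g (at x)" if "x \<in> S" for x
    by (rule frechet_derivative_cong_open[OF assms(1) that Suc.prems])
  have "f differentiable (at x) \<longleftrightarrow> g differentiable (at x)" if "x \<in> S" for x
    by (rule differentiable_cong_open[OF assms(1) that Suc.prems])
  moreover have "Ck_on k S (\<lambda>x. dir_deriv f x u) \<longleftrightarrow> Ck_on k S (\<lambda>x. dir_deriv g x u)" for u
    by (rule Suc.IH) (simp add: D)
  ultimately show ?case by simp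
qed

lemma Ck_on_SucD: "Ck_on (Suc k) S f \<Longrightarrow> Ck_on k S f"
proof (induction k arbitrary: f)
  case 0
  then show ?case
    by (auto intro!: continuous_at_imp_continuous_on differentiable_imp_continuous_within)
next
  case (Suc k)
  then show ?case by simp
qed

lemma Ck_on_const: "Ck_on k S (\<lambda>_. c)"
  by (induction k arbitrary: c) auto

lemma Ck_on_add:
  assumes "open S" "Ck_on k S f" "Ck_on k S g"
  shows "Ck_on k S (\<lambda>x. f x + g x)"
  using assms(2,3)
proof (induction k arbitrary: f g)
  case 0
  then show ?case by (auto intro: continuous_on_add)
next
  case (Suc k)
  have "Ck_on k S (\<lambda>x. dir_deriv (\<lambda>x. f x + g x) x u)" for u
  proof (subst Ck_on_cong[OF assms(1)])
    show "dir_deriv (\<lambda>x. f x + g x) y u = dir_deriv f y u + dir_deriv g y u" if "y \<in> S" for y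
      using Suc.prems that by (intro dir_deriv_eq has_derivative_add has_derivative_dir_deriv) auto
    show "Ck_on k S (\<lambda>y. dir_deriv f y u + dir_deriv g y u)"
      using Suc by simp
  qed
  then show ?case using Suc.prems by simp
qed

lemma Ck_on_sum:
  assumes "open S" "\<And>i. i \<in> I \<Longrightarrow> Ck_on k S (f i)"
  shows "Ck_on k S (\<lambda>x. \<Sum>i\<in>I. f i x)"
  using assms(2)
  by (induction I rule: infinite_finite_induct) (auto intro: Ck_on_add[OF assms(1)] Ck_on_const)

text \<open>The derivative is again a sum of products under the same \<open>p\<close>, with other
  factors; the induction therefore generalises over both of them.\<close>

lemma Ck_on_bilinear:
  assumes "bounded_bilinear p" "open S" "Ck_on k S f" "Ck_on k S g"
  shows "Ck_on k S (\<lambda>x. p (f x) (g x))"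
  using assms(3,4)
proof (induction k arbitrary: f g)
  case 0
  then show ?case using bounded_bilinear.continuous_on[OF assms(1)] by auto
next
  case (Suc k)
  have D: "((\<lambda>x. p (f x) (g x)) has_derivative
      (\<lambda>u. p (f y) (dir_deriv g y u) + p (dir_deriv f y u) (g y))) (at y)" if "y \<in> S" for y
    using Suc.prems that by (intro bounded_bilinear.FDERIV[OF assms(1)] has_derivative_dir_deriv) auto
  have "Ck_on k S (\<lambda>x. dir_deriv (\<lambda>x. p (f x) (g x)) x u)" for u
  proof (subst Ck_on_cong[OF assms(2)])
    show "dir_deriv (\<lambda>x. p (f x) (g x)) y u = p (f y) (dir_deriv g y u) + p (dir_deriv f y u) (g y)"
      if "y \<in> S" for y
      using D[OF that] by (rule dir_deriv_eq)
    show "Ck_on k S (\<lambda>y. p (f y) (dir_deriv g y u) + p (dir_deriv f y u) (g y))"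
      using Suc.prems Ck_on_SucD[OF Suc.prems(1)] Ck_on_SucD[OF Suc.prems(2)]
      by (intro Ck_on_add[OF assms(2)] Suc.IH) auto
  qed
  moreover have "(\<lambda>x. p (f x) (g x)) differentiable (at y)" if "y \<in> S" for y
    using D[OF that] differentiable_def by blast
  ultimately show ?case by simp
qed

lemma Ck_on_linear:
  fixes L :: "'b::real_normed_vector \<Rightarrow> 'c::real_normed_vector"
  assumes "bounded_linear L" "open S" "Ck_on k S f"
  shows "Ck_on k S (\<lambda>x. L (f x))"
  using assms(3)
proof (induction k arbitrary: f)
  case 0
  then show ?case using bounded_linear.continuous_on[OF assms(1)] by auto
next
  case (Suc k)
  have D: "((\<lambda>x. L (f x)) has_derivative (\<lambda>u. L (dir_deriv f y u))) (at y)" if "y \<in> S" for y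
    using Suc.prems that
    by (intro bounded_linear.has_derivative[OF assms(1)] has_derivative_dir_deriv) auto
  have "Ck_on k S (\<lambda>x. dir_deriv (\<lambda>x. L (f x)) x u)" for u
  proof (subst Ck_on_cong[OF assms(2)])
    show "dir_deriv (\<lambda>x. L (f x)) y u = L (dir_deriv f y u)" if "y \<in> S" for y
      using D[OF that] by (rule dir_deriv_eq)
    show "Ck_on k S (\<lambda>y. L (dir_deriv f y u))"
      using Suc by simp
  qed
  moreover have "(\<lambda>x. L (f x)) differentiable (at y)" if "y \<in> S" for y
    using D[OF that] differentiable_def by blast
  ultimately show ?case by simp
qed

text \<open>The chain rule feeds the varying vector \<open>dir_deriv f y u\<close> to the derivative
  of \<open>g\<close>, whereas \<open>Ck_on\<close> controls derivatives along constant vectors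
  only. Expanding that vector over \<open>Basis\<close> leaves finitely many products covered by the
  induction hypothesis.\<close>

lemma Ck_on_compose:
  fixes f :: "'a::euclidean_space \<Rightarrow> 'b::euclidean_space" and g :: "'b \<Rightarrow> 'c::real_normed_vector"
  assumes "open S" "open T" "f ` S \<subseteq> T" "Ck_on k S f" "Ck_on k T g"
  shows "Ck_on k S (\<lambda>x. g (f x))"
  using assms(4,5)
proof (induction k arbitrary: g)
  case 0
  then show ?case using assms(3) continuous_on_compose2[of T g S f] by simp
next
  case (Suc k)
  have D: "((\<lambda>x. g (f x)) has_derivative (\<lambda>u. dir_deriv g (f y) (dir_deriv f y u))) (at y)"
    if "y \<in> S" for y
    using Suc.prems that assms(3)
    by (intro has_derivative_compose[of f _ y UNIV g] has_derivative_dir_deriv) auto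
  have "Ck_on k S (\<lambda>x. dir_deriv (\<lambda>x. g (f x)) x u)" for u
  proof (subst Ck_on_cong[OF assms(1)])
    show "dir_deriv (\<lambda>x. g (f x)) y u =
        (\<Sum>i\<in>Basis. (dir_deriv f y u \<bullet> i) *\<^sub>R dir_deriv g (f y) i)" if "y \<in> S" for y
    proof -
      have "g differentiable (at (f y))" using that Suc.prems assms(3) by auto
      then show ?thesis
        using dir_deriv_eq[OF D[OF that]] linear_basis_expansion[OF linear_dir_deriv] by metis
    qed
    show "Ck_on k S (\<lambda>y. \<Sum>i\<in>Basis. (dir_deriv f y u \<bullet> i) *\<^sub>R dir_deriv g (f y) i)"
      using Suc.prems Ck_on_SucD[OF Suc.prems(1)]
      by (intro Ck_on_sum[OF assms(1)] Ck_on_bilinear[OF bounded_bilinear_scaleR assms(1)] Suc.IH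
          Ck_on_linear[OF bounded_linear_inner_left assms(1)]) auto
  qed
  moreover have "(\<lambda>x. g (f x)) differentiable (at y)" if "y \<in> S" for y
    using D[OF that] differentiable_def by blast
  ultimately show ?case by simp
qed

lemma smooth_on_Ck_on: "smooth_on S f \<Longrightarrow> Ck_on k S f"
  by (simp add: smooth_on_def)

lemma smooth_on_differentiable: "smooth_on S f \<Longrightarrow> x \<in> S \<Longrightarrow> f differentiable (at x)"
  using smooth_on_Ck_on[of S f "Suc 0"] by simp

lemma smooth_on_has_derivative:
  "smooth_on S f \<Longrightarrow> x \<in> S \<Longrightarrow> (f has_derivative dir_deriv f x) (at x)"
  by (rule has_derivative_dir_deriv[OF smooth_on_differentiable])

lemma smooth_on_linear_deriv: "smooth_on S f \<Longrightarrow> x \<in> S \<Longrightarrow> linear (dir_deriv f x)"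
  by (rule linear_dir_deriv[OF smooth_on_differentiable])

lemma smooth_on_dir_deriv: "smooth_on S f \<Longrightarrow> smooth_on S (\<lambda>x. dir_deriv f x u)"
proof -
  assume "smooth_on S f"
  then have "Ck_on (Suc k) S f" for k by (rule smooth_on_Ck_on)
  then show ?thesis by (simp add: smooth_on_def)
qed

lemma smooth_on_imp_continuous_on: "smooth_on S f \<Longrightarrow> continuous_on S f"
  using smooth_on_Ck_on[of S f 0] by simp

lemma smooth_on_linear: "bounded_linear L \<Longrightarrow> open S \<Longrightarrow> smooth_on S f \<Longrightarrow> smooth_on S (\<lambda>x. L (f x))"
  unfolding smooth_on_def using Ck_on_linear[of L S _ f] by simp

lemma smooth_on_sum:
  "open S \<Longrightarrow> (\<And>i. i \<in> I \<Longrightarrow> smooth_on S (f i)) \<Longrightarrow> smooth_on S (\<lambda>x. \<Sum>i\<in>I. f i x)"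
  unfolding smooth_on_def using Ck_on_sum[of S I _ f] by simp

lemma smooth_on_bilinear:
  "bounded_bilinear p \<Longrightarrow> open S \<Longrightarrow> smooth_on S f \<Longrightarrow> smooth_on S g \<Longrightarrow> smooth_on S (\<lambda>x. p (f x) (g x))"
  unfolding smooth_on_def using Ck_on_bilinear[of p S _ f g] by simp

lemma smooth_on_compose:
  fixes f :: "'a::euclidean_space \<Rightarrow> 'b::euclidean_space" and g :: "'b \<Rightarrow> 'c::real_normed_vector"
  assumes "open S" "open T" "f ` S \<subseteq> T" "smooth_on S f" "smooth_on T g"
  shows "smooth_on S (\<lambda>x. g (f x))"
  unfolding smooth_on_def
  by (rule allI, rule Ck_on_compose[OF assms(1-3) assms(4,5)[THEN smooth_on_Ck_on]])

section \<open>Symmetry of second derivatives\<close>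

text \<open>The second difference is symmetric in \<open>u\<close> and \<open>v\<close>, the mixed
  derivative on the right is not visibly so; exchanging the two vectors compares both orders of
  differentiation.\<close>

lemma second_difference:
  fixes f :: "'a::euclidean_space \<Rightarrow> real"
  assumes S: "ball x r \<subseteq> S" and f: "smooth_on S f"
    and h: "h > 0" "h * norm u + h * norm v < r"
  shows "\<exists>p\<in>ball x r. f (x + h *\<^sub>R u + h *\<^sub>R v) - f (x + h *\<^sub>R u) - f (x + h *\<^sub>R v) + f x =
    h * h * dir_deriv (\<lambda>y. dir_deriv f y u) p v"
proof -
  have mem: "x + s *\<^sub>R u + k *\<^sub>R v \<in> ball x r" if "0 \<le> s" "s \<le> h" "0 \<le> k" "k \<le> h" for s k
  proof -
    have "norm (s *\<^sub>R u + k *\<^sub>R v) \<le> s * norm u + k * norm v"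
      using norm_triangle_ineq[of "s *\<^sub>R u" "k *\<^sub>R v"] that by simp
    also have "\<dots> \<le> h * norm u + h * norm v"
      using that by (intro add_mono mult_right_mono) auto
    also have "\<dots> < r" by (rule h)
    finally show ?thesis by (simp add: dist_norm norm_minus_commute algebra_simps)
  qed
  have line: "((\<lambda>s. g (a + s *\<^sub>R w)) has_real_derivative dir_deriv g (a + s *\<^sub>R w) w) (at s)"
    if g: "g differentiable (at (a + s *\<^sub>R w))" for g :: "'a \<Rightarrow> real" and a w s
  proof -
    have "((\<lambda>s. a + s *\<^sub>R w) has_derivative (\<lambda>s. s *\<^sub>R w)) (at s)"
      by (auto intro!: derivative_eq_intros)
    then have "((\<lambda>s. g (a + s *\<^sub>R w)) has_derivative (\<lambda>k. dir_deriv g (a + s *\<^sub>R w) (k *\<^sub>R w))) (at s)"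
      by (rule has_derivative_compose) (rule has_derivative_dir_deriv[OF g])
    moreover have "(\<lambda>k. dir_deriv g (a + s *\<^sub>R w) (k *\<^sub>R w)) = (*) (dir_deriv g (a + s *\<^sub>R w) w)"
      using linear_cmul[OF linear_dir_deriv[OF g]] by (auto simp: mult.commute)
    ultimately show ?thesis by (simp add: has_field_derivative_def)
  qed
  have fd: "f differentiable (at y)" if "y \<in> ball x r" for y
    using smooth_on_differentiable[OF f] S that by blast
  have gd: "(\<lambda>y. dir_deriv f y u) differentiable (at y)" if "y \<in> ball x r" for y
    using smooth_on_differentiable[OF smooth_on_dir_deriv[OF f]] S that by blast
  \<comment> \<open>The second difference is an increment of \<open>\<phi>\<close>. The mean value
    theorem along \<open>u\<close> gives a difference of first derivatives, and a second application
    along \<open>v\<close> gives the mixed derivative.\<close>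
  define \<phi> where "\<phi> s = f ((x + h *\<^sub>R v) + s *\<^sub>R u) - f (x + s *\<^sub>R u)" for s
  have "\<exists>z. 0 < z \<and> z < h \<and> \<phi> h - \<phi> 0 =
      (h - 0) * (dir_deriv f ((x + h *\<^sub>R v) + z *\<^sub>R u) u - dir_deriv f (x + z *\<^sub>R u) u)"
  proof (rule MVT2)
    fix s assume s: "0 \<le> s" "s \<le> h"
    have "x + h *\<^sub>R v + s *\<^sub>R u \<in> ball x r" "x + s *\<^sub>R u \<in> ball x r"
      using mem[of s h] mem[of s 0] s h(1) by (simp_all add: algebra_simps)
    then show "(\<phi> has_real_derivative
        dir_deriv f (x + h *\<^sub>R v + s *\<^sub>R u) u - dir_deriv f (x + s *\<^sub>R u) u) (at s)"
      unfolding \<phi>_def by (intro DERIV_diff line fd)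
  qed (use h in auto)
  then obtain z where z: "0 < z" "z < h" and e1: "\<phi> h - \<phi> 0 =
      h * (dir_deriv f ((x + h *\<^sub>R v) + z *\<^sub>R u) u - dir_deriv f (x + z *\<^sub>R u) u)" by auto
  have "\<exists>k. 0 < k \<and> k < h \<and>
      dir_deriv f (x + z *\<^sub>R u + h *\<^sub>R v) u - dir_deriv f (x + z *\<^sub>R u + 0 *\<^sub>R v) u =
      (h - 0) * dir_deriv (\<lambda>y. dir_deriv f y u) (x + z *\<^sub>R u + k *\<^sub>R v) v"
  proof (rule MVT2)
    fix s assume s: "0 \<le> s" "s \<le> h"
    show "((\<lambda>s. dir_deriv f (x + z *\<^sub>R u + s *\<^sub>R v) u) has_real_derivative
        dir_deriv (\<lambda>y. dir_deriv f y u) (x + z *\<^sub>R u + s *\<^sub>R v) v) (at s)"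
      by (rule line, rule gd, rule mem) (use s z in auto)
  qed (use h in auto)
  then obtain k where k: "0 < k" "k < h" and
    e2: "dir_deriv f (x + z *\<^sub>R u + h *\<^sub>R v) u - dir_deriv f (x + z *\<^sub>R u) u =
      h * dir_deriv (\<lambda>y. dir_deriv f y u) (x + z *\<^sub>R u + k *\<^sub>R v) v" by auto
  have "\<phi> h - \<phi> 0 = h * h * dir_deriv (\<lambda>y. dir_deriv f y u) (x + z *\<^sub>R u + k *\<^sub>R v) v"
    using e1 e2 by (simp add: add_ac)
  then show ?thesis
    using mem[of z k] z k unfolding \<phi>_def
    by (intro bexI[of _ "x + z *\<^sub>R u + k *\<^sub>R v"]) (auto simp: algebra_simps)
qed

text \<open>Both orders of differentiation compute the same second difference, at points
  \<open>p\<close> and \<open>q\<close> near \<open>x\<close>, so \<open>A p = B q\<close>. If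
  \<open>A x\<close> and \<open>B x\<close> differed, continuity would keep both functions within
  half the gap of their values at \<open>x\<close>.\<close>

lemma dir_deriv_symmetric_real:
  fixes f :: "'a::euclidean_space \<Rightarrow> real"
  assumes "open S" "x \<in> S" "smooth_on S f"
  shows "dir_deriv (\<lambda>y. dir_deriv f y u) x v = dir_deriv (\<lambda>y. dir_deriv f y v) x u"
proof (rule ccontr)
  define A where "A p = dir_deriv (\<lambda>y. dir_deriv f y u) p v" for p
  define B where "B p = dir_deriv (\<lambda>y. dir_deriv f y v) p u" for p
  assume "\<not> ?thesis"
  then have ne: "dist (A x) (B x) > 0" by (simp add: A_def B_def)
  have cont: "continuous_on S A" "continuous_on S B"
    unfolding A_def B_def
    by (intro smooth_on_imp_continuous_on smooth_on_dir_deriv assms)+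
  have cx: "continuous (at x) A" "continuous (at x) B"
    using cont assms continuous_on_eq_continuous_at by blast+
  obtain d1 where d1: "d1 > 0" "\<And>y. dist y x < d1 \<Longrightarrow> dist (A y) (A x) < dist (A x) (B x) / 2"
    using cx(1)[unfolded continuous_at_eps_delta, rule_format, OF half_gt_zero[OF ne]] by blast
  obtain d2 where d2: "d2 > 0" "\<And>y. dist y x < d2 \<Longrightarrow> dist (B y) (B x) < dist (A x) (B x) / 2"
    using cx(2)[unfolded continuous_at_eps_delta, rule_format, OF half_gt_zero[OF ne]] by blast
  obtain d3 where d3: "d3 > 0" "ball x d3 \<subseteq> S" using assms open_contains_ball by blast
  define r where "r = min d1 (min d2 d3)"
  have r: "r > 0" "ball x r \<subseteq> S" using d1 d2 d3 by (auto simp: r_def)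
  \<comment> \<open>Chosen so that the parallelogram spanned by \<open>h *\<^sub>R u\<close> and
    \<open>h *\<^sub>R v\<close> stays in the ball; the summand 1 keeps the denominator positive
    when both vectors vanish.\<close>
  define h where "h = r / (2 * (norm u + norm v + 1))"
  have pos: "norm u + norm v + 1 > 0" by (simp add: add_nonneg_pos)
  have h: "h > 0" using r(1) pos by (simp add: h_def)
  have "h * norm u + h * norm v \<le> h * (norm u + norm v + 1)" using h by (simp add: algebra_simps)
  also have "\<dots> = r / 2" using pos by (simp add: h_def field_simps)
  finally have h2: "h * norm u + h * norm v < r" using r(1) by simp
  obtain p where p: "p \<in> ball x r"
    "f (x + h *\<^sub>R u + h *\<^sub>R v) - f (x + h *\<^sub>R u) - f (x + h *\<^sub>R v) + f x = h * h * A p"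
    using second_difference[OF r(2) assms(3) h h2] by (auto simp: A_def)
  obtain q where q: "q \<in> ball x r"
    "f (x + h *\<^sub>R v + h *\<^sub>R u) - f (x + h *\<^sub>R v) - f (x + h *\<^sub>R u) + f x = h * h * B q"
    using second_difference[OF r(2) assms(3) h, of v u] h2 by (auto simp: B_def)
  have "x + h *\<^sub>R u + h *\<^sub>R v = x + h *\<^sub>R v + h *\<^sub>R u" by simp
  then have "f (x + h *\<^sub>R u + h *\<^sub>R v) = f (x + h *\<^sub>R v + h *\<^sub>R u)" by (rule arg_cong)
  then have "h * h * A p = h * h * B q"
    using p(2) q(2) by linarith
  then have "A p = B q" using h by simp
  moreover have "dist (A p) (A x) < dist (A x) (B x) / 2" "dist (B q) (B x) < dist (A x) (B x) / 2"
    using p q d1 d2 by (auto simp: r_def dist_commute)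
  moreover have "dist (A x) (B x) \<le> dist (A p) (A x) + dist (A p) (B x)"
    by (rule dist_triangle3)
  ultimately have "dist (A x) (B x) < dist (A x) (B x) / 2 + dist (A x) (B x) / 2" by simp
  then show False by simp
qed

lemma dir_deriv_linear:
  assumes "bounded_linear L" "f differentiable (at x)"
  shows "dir_deriv (\<lambda>y. L (f y)) x u = L (dir_deriv f x u)"
  by (intro dir_deriv_eq bounded_linear.has_derivative[OF assms(1)] has_derivative_dir_deriv assms)

lemma dir_deriv_symmetric:
  fixes f :: "'a::euclidean_space \<Rightarrow> 'b::euclidean_space"
  assumes "open S" "x \<in> S" "smooth_on S f"
  shows "dir_deriv (\<lambda>y. dir_deriv f y u) x v = dir_deriv (\<lambda>y. dir_deriv f y v) x u"
proof (rule euclidean_eqI)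
  fix b :: 'b
  have bl: "bounded_linear (\<lambda>z::'b. z \<bullet> b)" by (rule bounded_linear_inner_left)
  have D: "dir_deriv (\<lambda>y. dir_deriv (\<lambda>y. f y \<bullet> b) y w) x z = dir_deriv (\<lambda>y. dir_deriv f y w) x z \<bullet> b"
    for w z
  proof -
    have "dir_deriv (\<lambda>y. dir_deriv (\<lambda>y. f y \<bullet> b) y w) x z = dir_deriv (\<lambda>y. dir_deriv f y w \<bullet> b) x z"
      by (rule arg_cong[where f="\<lambda>D. D z"], rule frechet_derivative_cong_open[OF assms(1,2)])
        (rule dir_deriv_linear[OF bl smooth_on_differentiable[OF assms(3)]])
    also have "\<dots> = dir_deriv (\<lambda>y. dir_deriv f y w) x z \<bullet> b"
      by (rule dir_deriv_linear[OF bl smooth_on_differentiable[OF smooth_on_dir_deriv[OF assms(3)] assms(2)]])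
    finally show ?thesis .
  qed
  have "smooth_on S (\<lambda>y. f y \<bullet> b)" by (rule smooth_on_linear[OF bl assms(1,3)])
  from dir_deriv_symmetric_real[OF assms(1,2) this, of u v]
  show "dir_deriv (\<lambda>y. dir_deriv f y u) x v \<bullet> b = dir_deriv (\<lambda>y. dir_deriv f y v) x u \<bullet> b"
    by (simp add: D)
qed

section \<open>Inner products, index raising and traces\<close>

locale inner_form =
  fixes g :: "'a::euclidean_space \<Rightarrow> 'a \<Rightarrow> real"
  assumes bilinear: "bilinear g" and commute: "g u v = g v u" and pos: "u \<noteq> 0 \<Longrightarrow> g u u > 0"
begin

lemmas form_simps =
  bilinear_ladd[OF bilinear] bilinear_radd[OF bilinear] bilinear_lsub[OF bilinear]
  bilinear_rsub[OF bilinear] bilinear_lmul[OF bilinear] bilinear_rmul[OF bilinear]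
  bilinear_lneg[OF bilinear] bilinear_rneg[OF bilinear]
  bilinear_lzero[OF bilinear] bilinear_rzero[OF bilinear]

lemma linear_right: "linear (g u)"
  using bilinear by (simp add: bilinear_def)

lemma linear_left: "linear (\<lambda>v. g v u)"
  using bilinear by (simp add: bilinear_def)

lemma zero_iff: "g u u = 0 \<longleftrightarrow> u = 0"
  using pos[of u] by (cases "u = 0") (auto simp: form_simps)

lemma eqI: "(\<And>w. g u w = g v w) \<Longrightarrow> u = v"
  using zero_iff[of "u - v"] by (simp add: form_simps)

text \<open>Riesz representation by counting dimensions: recording the values on
  \<open>Basis\<close> is an injective endomorphism, hence surjective.\<close>

lemma ex_representer:
  assumes "linear \<alpha>"
  shows "\<exists>z. \<forall>w. g z w = \<alpha> w"
proof -
  define A where "A z = (\<Sum>i\<in>Basis. g z i *\<^sub>R i)" for z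
  have A: "A z \<bullet> i = g z i" if "i \<in> Basis" for z i
    using that by (simp add: A_def)
  have lin: "linear A"
    unfolding A_def
    by (intro linear_compose_sum ballI linearI) (auto simp: form_simps algebra_simps)
  moreover have "inj A"
  proof (rule inj_onI)
    fix u v assume "A u = A v"
    then have "g u i = g v i" if "i \<in> Basis" for i using A[OF that] by metis
    then have "g u w = g v w" for w
      by (subst (1 2) linear_basis_expansion[OF linear_right]) (simp cong: sum.cong)
    then show "u = v" by (rule eqI)
  qed
  ultimately have "surj A" by (rule linear_injective_imp_surjective) simp
  then obtain z where z: "A z = (\<Sum>i\<in>Basis. \<alpha> i *\<^sub>R i)" by (metis surjD)
  have "g z i = \<alpha> i" if "i \<in> Basis" for i
    using A[OF that, of z] that by (simp add: z)
  then have "g z w = \<alpha> w" for w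
    by (subst linear_basis_expansion[OF linear_right], subst linear_basis_expansion[OF assms])
      (simp cong: sum.cong)
  then show ?thesis by blast
qed

lemma sharp_eqI: "(\<And>w. g z w = \<alpha> w) \<Longrightarrow> sharp g \<alpha> = z"
  unfolding sharp_def by (rule the_equality) (auto intro: eqI)

lemma form_sharp: "linear \<alpha> \<Longrightarrow> g (sharp g \<alpha>) w = \<alpha> w"
  using ex_representer sharp_eqI by metis

lemma form_sharp_inner: "g (sharp g (\<lambda>w. w \<bullet> i)) w = w \<bullet> i"
  by (rule form_sharp) (rule bounded_linear.linear[OF bounded_linear_inner_left])

text \<open>The vectors \<open>sharp g (\<lambda>w. w \<bullet> i)\<close> form the basis dual to
  \<open>Basis\<close> with respect to \<open>g\<close>, and in it the coordinates of
  \<open>sharp g \<alpha>\<close> are the values \<open>\<alpha> i\<close>.\<close>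

lemma metric_trace_left:
  assumes "linear \<alpha>" "linear L"
  shows "metric_trace g (\<lambda>u v. \<alpha> u *\<^sub>R L v) = L (sharp g \<alpha>)"
proof -
  have "sharp g \<alpha> = (\<Sum>i\<in>Basis. \<alpha> i *\<^sub>R sharp g (\<lambda>w. w \<bullet> i))"
  proof (rule sharp_eqI)
    fix w
    have "g (\<Sum>i\<in>Basis. \<alpha> i *\<^sub>R sharp g (\<lambda>w. w \<bullet> i)) w = (\<Sum>i\<in>Basis. \<alpha> i * (w \<bullet> i))"
      by (simp add: linear_sum[OF linear_left] form_simps form_sharp_inner)
    also have "\<dots> = \<alpha> w"
      by (simp add: linear_basis_expansion[OF assms(1), of w] mult.commute)
    finally show "g (\<Sum>i\<in>Basis. \<alpha> i *\<^sub>R sharp g (\<lambda>w. w \<bullet> i)) w = \<alpha> w" .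
  qed
  then show ?thesis
    by (simp add: metric_trace_def linear_sum[OF assms(2)] linear_cmul[OF assms(2)])
qed

text \<open>Pairing with the dual basis reads off Euclidean coordinates, so the trace is obtained
  without an orthonormal frame.\<close>

lemma metric_trace_form:
  "metric_trace g (\<lambda>u v. g (A u) v) = op_trace A"
  unfolding metric_trace_def op_trace_def
  by (intro sum.cong refl) (subst commute, rule form_sharp_inner)

lemma metric_trace_right:
  assumes "linear \<alpha>" "linear L"
  shows "metric_trace g (\<lambda>u v. \<alpha> v *\<^sub>R L u) = L (sharp g \<alpha>)"
proof -
  have "\<alpha> (sharp g (\<lambda>w. w \<bullet> i)) = sharp g \<alpha> \<bullet> i" for i
    using form_sharp[OF assms(1), of "sharp g (\<lambda>w. w \<bullet> i)"] form_sharp_inner[of i "sharp g \<alpha>"]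
    by (simp add: commute)
  then show ?thesis
    unfolding metric_trace_def by (simp add: linear_basis_expansion[OF assms(2), of "sharp g \<alpha>"])
qed

end

lemma metric_trace_linear:
  "linear L \<Longrightarrow> L (metric_trace g b) = metric_trace g (\<lambda>u v. L (b u v))"
  unfolding metric_trace_def by (rule linear_sum)

lemma metric_trace_add:
  "metric_trace g (\<lambda>u v. a u v + b u v) = metric_trace g a + metric_trace g b"
  by (simp add: metric_trace_def sum.distrib)

lemma metric_trace_diff:
  "metric_trace g (\<lambda>u v. a u v - b u v) = metric_trace g a - metric_trace g b"
  by (simp add: metric_trace_def sum_subtractf)

lemma metric_trace_scaleR:
  "metric_trace g (\<lambda>u v. c *\<^sub>R a u v) = c *\<^sub>R metric_trace g a"
  by (simp add: metric_trace_def scaleR_sum_right)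

lemma metric_trace_mult:
  fixes a :: "'a::euclidean_space \<Rightarrow> 'a \<Rightarrow> real"
  shows "metric_trace g (\<lambda>u v. c * a u v) = c * metric_trace g a"
  using metric_trace_scaleR[of g c a] by simp

lemma metric_trace_scaleR_left:
  "metric_trace g (\<lambda>u v. a u v *\<^sub>R n) = metric_trace g a *\<^sub>R n"
  by (simp add: metric_trace_def scaleR_sum_left)

lemma op_trace_add: "op_trace (\<lambda>u. A u + B u) = op_trace A + op_trace B"
  by (simp add: op_trace_def sum.distrib inner_add_left)

lemma op_trace_diff: "op_trace (\<lambda>u. A u - B u) = op_trace A - op_trace B"
  by (simp add: op_trace_def sum_subtractf inner_diff_left)

lemma op_trace_scaleR: "op_trace (\<lambda>u. c *\<^sub>R A u) = c * op_trace A"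
  by (simp add: op_trace_def sum_distrib_left)

lemma op_trace_id: "op_trace (\<lambda>u::'a::euclidean_space. u) = real DIM('a)"
  by (simp add: op_trace_def)

lemma op_trace_rank_one:
  assumes "linear \<alpha>"
  shows "op_trace (\<lambda>u. \<alpha> u *\<^sub>R z) = \<alpha> z"
  unfolding op_trace_def by (subst linear_basis_expansion[OF assms, of z]) (simp add: mult.commute)

lemma (in inner_form) metric_trace_self: "metric_trace g g = real DIM('a)"
  using metric_trace_form[of "\<lambda>u. u"] by (simp add: op_trace_id)

text \<open>Codimension one enters here: \<open>n\<close> and the range of \<open>L\<close> span the
  whole space, so \<open>V\<close> minus its \<open>n\<close>-component is orthogonal to everything,
  in particular to itself.\<close>

lemma orthogonal_complement_decomp:
  fixes h :: "'b::euclidean_space \<Rightarrow> 'b \<Rightarrow> real" and L :: "'a::euclidean_space \<Rightarrow> 'b"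
  assumes h: "inner_form h" and dim: "DIM('b) = DIM('a) + 1"
    and L: "linear L" "inj L" and n: "h n n = 1" "\<And>u. h n (L u) = 0" and V: "\<And>u. h V (L u) = 0"
  shows "V = h V n *\<^sub>R n"
proof -
  interpret inner_form h by (rule h)
  define X where "X = V - h V n *\<^sub>R n"
  have Xn: "h X n = 0" and XL: "h X (L u) = 0" for u
    using n V by (simp_all add: X_def form_simps)
  have "n \<notin> range L"
  proof
    assume "n \<in> range L"
    then have "h n n = 0" using n(2) by auto
    then show False using n(1) by simp
  qed
  moreover have "subspace (range L)"
    by (rule linear_subspace_image[OF L(1) subspace_UNIV])
  ultimately have "n \<notin> span (range L)"
    using span_eq_iff by blast
  moreover have "dim (range L) = DIM('a)"
    using dim_image_eq[OF L(1), of UNIV] L(2) by simp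
  ultimately have "dim (insert n (range L)) = DIM('b)"
    by (simp add: dim dim_insert)
  then have mem: "X \<in> span (insert n (range L))"
    using dim_eq_full by blast
  have orth: "h X b = 0" if "b \<in> insert n (range L)" for b
    using that Xn XL by blast
  have "h X X = 0"
    by (rule linear_eq_0_on_span[OF linear_right orth mem])
  then show ?thesis using zero_iff[of X] by (simp add: X_def)
qed

section \<open>Differentiability of index raising\<close>

text \<open>Where the scalar factor vanishes, the product rule asks only for continuity of the other
  factor. This is how continuity of the inverse Gram matrix suffices to differentiate
  \<open>sharp\<close>.\<close>

lemma has_derivative_scaleR_vanishing:
  fixes r :: "'x::real_normed_vector \<Rightarrow> real" and c :: "'x \<Rightarrow> 'b::real_normed_vector"
  assumes r: "(r has_derivative r') (at x)" "r x = 0" and c: "isCont c x"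
  shows "((\<lambda>y. r y *\<^sub>R c y) has_derivative (\<lambda>h. r' h *\<^sub>R c x)) (at x)"
proof -
  have bl: "bounded_linear r'" using r(1) has_derivative_bounded_linear by blast
  obtain K where K: "\<And>h. norm (r' h) \<le> norm h * K" using bounded_linear.bounded[OF bl] by blast
  have lim: "((\<lambda>y. norm (r y - r x - r' (y - x)) / norm (y - x)) \<longlongrightarrow> 0) (at x)"
    using r(1) by (simp add: has_derivative_iff_norm)
  have cl: "(c \<longlongrightarrow> c x) (at x)" using c by (simp add: isCont_def)
  let ?R = "\<lambda>y. norm (r y - r x - r' (y - x)) / norm (y - x)"
  have "((\<lambda>y. norm (r y *\<^sub>R c y - r x *\<^sub>R c x - r' (y - x) *\<^sub>R c x) / norm (y - x)) \<longlongrightarrow> 0) (at x)"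
  proof (rule tendsto_0_le[where K=1])
    have "((\<lambda>y. ?R y * norm (c y) + K * norm (c y - c x)) \<longlongrightarrow> 0 * norm (c x) + K * norm (c x - c x)) (at x)"
      by (intro tendsto_intros lim cl)
    then show "((\<lambda>y. ?R y * norm (c y) + K * norm (c y - c x)) \<longlongrightarrow> 0) (at x)" by simp
    have "norm (r y *\<^sub>R c y - r x *\<^sub>R c x - r' (y - x) *\<^sub>R c x) / norm (y - x)
        \<le> ?R y * norm (c y) + K * norm (c y - c x)" if "y \<noteq> x" for y
    proof -
      have "r y *\<^sub>R c y - r x *\<^sub>R c x - r' (y - x) *\<^sub>R c x =
          (r y - r x - r' (y - x)) *\<^sub>R c y + r' (y - x) *\<^sub>R (c y - c x)"
        using r(2) by (simp add: algebra_simps)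
      also have "norm \<dots> \<le> norm (r y - r x - r' (y - x)) * norm (c y) + norm (r' (y - x)) * norm (c y - c x)"
        by (rule order_trans[OF norm_triangle_ineq]) simp
      also have "\<dots> \<le> norm (r y - r x - r' (y - x)) * norm (c y) + norm (y - x) * K * norm (c y - c x)"
        by (intro add_left_mono mult_right_mono K) simp
      finally show ?thesis using that by (simp add: field_simps)
    qed
    then show "\<forall>\<^sub>F y in at x. norm (norm (r y *\<^sub>R c y - r x *\<^sub>R c x - r' (y - x) *\<^sub>R c x) / norm (y - x))
        \<le> norm (?R y * norm (c y) + K * norm (c y - c x)) * 1"
      unfolding eventually_at_filter by (intro always_eventually allI impI) (simp add: order_trans[OF _ abs_ge_self])
  qed
  moreover have "bounded_linear (\<lambda>h. r' h *\<^sub>R c x)"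
    by (rule bounded_linear_compose[OF bounded_linear_scaleR_left bl])
  ultimately show ?thesis by (simp add: has_derivative_iff_norm)
qed

text \<open>The Gram operator \<open>A y\<close> maps \<open>d y\<close> to a vector that does not
  depend on \<open>y\<close>, so \<open>A y (d y - d x) = A x (d x) - A y (d x)\<close>, which tends
  to 0. As \<open>A x\<close> is bounded below by \<open>B\<close>, nearby \<open>A y\<close> are
  bounded below by \<open>B / 2\<close>, and \<open>d y\<close> tends to \<open>d x\<close>.\<close>

lemma isCont_sharp_inner:
  fixes G :: "'x::real_normed_vector \<Rightarrow> 'a::euclidean_space \<Rightarrow> 'a \<Rightarrow> real"
  assumes U: "open U" "x \<in> U" and G: "\<And>y. y \<in> U \<Longrightarrow> inner_form (G y)"
    and cont: "\<And>u v. isCont (\<lambda>y. G y u v) x"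
  shows "isCont (\<lambda>y. sharp (G y) (\<lambda>w. w \<bullet> i)) x"
proof -
  define A where "A y z = (\<Sum>j\<in>Basis. G y z j *\<^sub>R j)" for y z
  define d where "d y = sharp (G y) (\<lambda>w. w \<bullet> i)" for y
  have Aj: "A y z \<bullet> j = G y z j" if "j \<in> Basis" for y z j using that by (simp add: A_def)
  have lin: "linear (A y)" if "y \<in> U" for y
    unfolding A_def using inner_form.form_simps[OF G[OF that]]
    by (intro linear_compose_sum ballI linearI) (auto simp: algebra_simps)
  have inj: "inj (A x)"
    unfolding linear_injective_0[OF lin[OF U(2)]]
  proof (intro allI impI)
    fix z assume "A x z = 0"
    then have "G x z j = 0" if "j \<in> Basis" for j using Aj[OF that, of x z] by simp
    then have "G x z z = 0"
      by (subst linear_basis_expansion[OF inner_form.linear_right[OF G[OF U(2)]]]) simp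
    then show "z = 0" using inner_form.zero_iff[OF G[OF U(2)]] by simp
  qed
  obtain B where B: "B > 0" "\<And>z. B * norm z \<le> norm (A x z)"
    using linear_inj_bounded_below_pos[OF lin[OF U(2)] inj] by blast
  have Ad: "A y (d y) = A x (d x)" if "y \<in> U" for y
    using inner_form.form_sharp_inner[OF G[OF that]] inner_form.form_sharp_inner[OF G[OF U(2)]]
    by (simp add: A_def d_def)
  have Ac: "((\<lambda>y. A y z) \<longlongrightarrow> A x z) (at x)" for z
    unfolding A_def using cont by (intro tendsto_intros) (auto simp: isCont_def)
  define e where "e y = (\<Sum>j\<in>Basis. norm (A y j - A x j))" for y
  have "(e \<longlongrightarrow> (\<Sum>j\<in>(Basis::'a set). norm (A x j - A x j))) (at x)"
    unfolding e_def by (intro tendsto_intros Ac)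
  then have e0: "(e \<longlongrightarrow> 0) (at x)" by simp
  have eb: "norm (A y z - A x z) \<le> e y * norm z" if "y \<in> U" for y z
  proof -
    have "A y z - A x z = (\<Sum>j\<in>Basis. (z \<bullet> j) *\<^sub>R (A y j - A x j))"
      by (subst linear_basis_expansion[OF lin[OF that], of z], subst linear_basis_expansion[OF lin[OF U(2)], of z])
        (simp add: sum_subtractf[symmetric] algebra_simps)
    also have "norm \<dots> \<le> (\<Sum>j\<in>Basis. norm z * norm (A y j - A x j))"
      by (intro sum_norm_le) (auto intro: mult_right_mono simp: Basis_le_norm)
    finally show ?thesis by (simp add: e_def sum_distrib_left mult.commute)
  qed
  have ev: "\<forall>\<^sub>F y in at x. norm (d y - d x) \<le> norm (A y (d x) - A x (d x)) * (2 / B)"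
  proof -
    have "\<forall>\<^sub>F y in at x. e y < B / 2" using order_tendstoD(2)[OF e0, of "B / 2"] B(1) by simp
    moreover have "\<forall>\<^sub>F y in at x. y \<in> U" by (rule eventually_at_topological[THEN iffD2]) (use U in blast)
    ultimately show ?thesis
    proof eventually_elim
      case (elim y)
      let ?w = "d y - d x"
      have "B * norm ?w \<le> norm (A x ?w)" by (rule B(2))
      also have "A x ?w = A y ?w - (A y ?w - A x ?w)" by simp
      also have "norm \<dots> \<le> norm (A y ?w) + e y * norm ?w"
        by (rule order_trans[OF norm_triangle_ineq4]) (use eb[OF elim(2)] in simp)
      also have "\<dots> \<le> norm (A y ?w) + B / 2 * norm ?w"
        using elim(1) by (intro add_left_mono mult_right_mono) auto
      finally have "B / 2 * norm ?w \<le> norm (A y ?w)" by simp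
      also have "A y ?w = A x (d x) - A y (d x)"
        using Ad[OF elim(2)] by (simp add: linear_diff[OF lin[OF elim(2)]])
      finally show ?case using B(1) by (simp add: field_simps norm_minus_commute)
    qed
  qed
  have "((\<lambda>y. A y (d x) - A x (d x)) \<longlongrightarrow> 0) (at x)" using Ac LIM_zero by blast
  then have "((\<lambda>y. d y - d x) \<longlongrightarrow> 0) (at x)" using ev by (rule tendsto_0_le)
  then show ?thesis unfolding isCont_def d_def by (rule LIM_zero_cancel)
qed

lemma differentiable_sharp:
  fixes G :: "'x::real_normed_vector \<Rightarrow> 'a::euclidean_space \<Rightarrow> 'a \<Rightarrow> real"
  assumes U: "open U" "x \<in> U" and G: "\<And>y. y \<in> U \<Longrightarrow> inner_form (G y)"
    and dG: "\<And>u v. (\<lambda>y. G y u v) differentiable (at x)"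
    and \<alpha>: "\<And>y. y \<in> U \<Longrightarrow> linear (\<alpha> y)" and d\<alpha>: "\<And>w. (\<lambda>y. \<alpha> y w) differentiable (at x)"
  shows "(\<lambda>y. sharp (G y) (\<alpha> y)) differentiable (at x)"
proof -
  define z where "z = sharp (G x) (\<alpha> x)"
  define r where "r i y = \<alpha> y i - G y z i" for i y
  define d where "d i y = sharp (G y) (\<lambda>w. w \<bullet> i)" for i y
  have rep: "sharp (G y) (\<alpha> y) = z + (\<Sum>i\<in>Basis. r i y *\<^sub>R d i y)" if y: "y \<in> U" for y
  proof -
    interpret inner_form "G y" by (rule G[OF y])
    show ?thesis
    proof (rule sharp_eqI)
      fix w
      have "G y (z + (\<Sum>i\<in>Basis. r i y *\<^sub>R d i y)) w = G y z w + (\<Sum>i\<in>Basis. (w \<bullet> i) * r i y)"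
        by (simp add: form_simps linear_sum[OF linear_left] d_def form_sharp_inner mult.commute)
      also have "(\<Sum>i\<in>Basis. (w \<bullet> i) * r i y) = \<alpha> y w - G y z w"
        by (subst linear_basis_expansion[OF \<alpha>[OF y], of w], subst linear_basis_expansion[OF linear_right, of z w])
          (simp add: r_def sum_subtractf algebra_simps)
      finally show "G y (z + (\<Sum>i\<in>Basis. r i y *\<^sub>R d i y)) w = \<alpha> y w" by simp
    qed
  qed
  have diff: "(\<lambda>y. r i y *\<^sub>R d i y) differentiable (at x)" for i
  proof -
    have "r i differentiable (at x)"
      unfolding r_def by (intro differentiable_diff dG d\<alpha>)
    then have "(r i has_derivative dir_deriv (r i) x) (at x)" by (rule has_derivative_dir_deriv)
    moreover have "r i x = 0"
      using inner_form.form_sharp[OF G \<alpha>, OF U(2) U(2)] by (simp add: r_def z_def)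
    moreover have "isCont (d i) x"
      unfolding d_def
      by (rule isCont_sharp_inner[OF U G]) (auto intro: dG differentiable_imp_continuous_within)
    ultimately show ?thesis
      using has_derivative_scaleR_vanishing differentiable_def by blast
  qed
  have "(\<lambda>y. z + (\<Sum>i\<in>Basis. r i y *\<^sub>R d i y)) differentiable (at x)"
    by (intro differentiable_add differentiable_sum differentiable_const) (simp_all add: diff)
  moreover have "(\<lambda>y. sharp (G y) (\<alpha> y)) differentiable (at x) \<longleftrightarrow>
      (\<lambda>y. z + (\<Sum>i\<in>Basis. r i y *\<^sub>R d i y)) differentiable (at x)"
    by (rule differentiable_cong_open[OF U rep])
  ultimately show ?thesis by blast
qed

section \<open>The Gauss equation\<close>

text \<open>The vectors are ordered as in the covariant derivative of \<open>v\<close> along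
  \<open>u\<close>, which matches \<open>christoffel G x u v\<close>.\<close>

abbreviation dir_deriv2 ::
    "('a::real_normed_vector \<Rightarrow> 'b::real_normed_vector) \<Rightarrow> 'a \<Rightarrow> 'a \<Rightarrow> 'a \<Rightarrow> 'b"
  where "dir_deriv2 f x u v \<equiv> dir_deriv (\<lambda>y. dir_deriv f y v) x u"

lemma linear_dir_deriv2_left:
  "smooth_on S f \<Longrightarrow> x \<in> S \<Longrightarrow> linear (\<lambda>u. dir_deriv2 f x u v)"
  by (rule smooth_on_linear_deriv[OF smooth_on_dir_deriv])

lemma linear_dir_deriv2_right:
  fixes f :: "'a::euclidean_space \<Rightarrow> 'b::euclidean_space"
  assumes "open S" "smooth_on S f" "x \<in> S"
  shows "linear (\<lambda>v. dir_deriv2 f x u v)"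
  using linear_dir_deriv2_left[OF assms(2,3), of u] dir_deriv_symmetric[OF assms(1,3,2)] by simp

text \<open>Derivative of a vector field pushed forward by \<open>g\<close>. The field is expanded
  over \<open>Basis\<close> so that only derivatives along constant vectors occur; linearity of the
  second derivative in its last vector comes from symmetry.\<close>

lemma has_derivative_pushforward:
  fixes g :: "'b::euclidean_space \<Rightarrow> 'c::euclidean_space"
  assumes S: "open S" "x \<in> S" "f ` S \<subseteq> T" and T: "open T" and g: "smooth_on T g"
    and f: "(f has_derivative f') (at x)" and V: "(V has_derivative V') (at x)"
  shows "((\<lambda>y. dir_deriv g (f y) (V y)) has_derivative
    (\<lambda>u. dir_deriv2 g (f x) (f' u) (V x) + dir_deriv g (f x) (V' u))) (at x)"
proof -
  have fx: "f x \<in> T" using S by blast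
  have lin: "linear (dir_deriv g (f y))" if "y \<in> S" for y
    using smooth_on_linear_deriv[OF g] S(3) that by blast
  have "((\<lambda>y. \<Sum>i\<in>Basis. (V y \<bullet> i) *\<^sub>R dir_deriv g (f y) i) has_derivative
      (\<lambda>u. \<Sum>i\<in>Basis. (V x \<bullet> i) *\<^sub>R dir_deriv2 g (f x) (f' u) i + (V' u \<bullet> i) *\<^sub>R dir_deriv g (f x) i)) (at x)"
  proof (intro has_derivative_sum has_derivative_scaleR)
    fix i :: 'b
    show "((\<lambda>y. V y \<bullet> i) has_derivative (\<lambda>u. V' u \<bullet> i)) (at x)"
      by (rule has_derivative_inner_left[OF V])
    show "((\<lambda>y. dir_deriv g (f y) i) has_derivative (\<lambda>u. dir_deriv2 g (f x) (f' u) i)) (at x)"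
      by (rule has_derivative_compose[OF f smooth_on_has_derivative[OF smooth_on_dir_deriv[OF g] fx]])
  qed
  moreover have "(\<Sum>i\<in>Basis. (V x \<bullet> i) *\<^sub>R dir_deriv2 g (f x) (f' u) i + (V' u \<bullet> i) *\<^sub>R dir_deriv g (f x) i)
      = dir_deriv2 g (f x) (f' u) (V x) + dir_deriv g (f x) (V' u)" for u
    using linear_basis_expansion[OF linear_dir_deriv2_right[OF T g fx, of "f' u"], of "V x"]
      linear_basis_expansion[OF lin[OF S(2)], of "V' u"]
    by (simp add: sum.distrib)
  ultimately have "((\<lambda>y. \<Sum>i\<in>Basis. (V y \<bullet> i) *\<^sub>R dir_deriv g (f y) i) has_derivative
      (\<lambda>u. dir_deriv2 g (f x) (f' u) (V x) + dir_deriv g (f x) (V' u))) (at x)"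
    by (simp only:)
  then show ?thesis
    by (rule has_derivative_transform_within_open[OF _ S(1,2)])
      (rule linear_basis_expansion[OF lin, symmetric])
qed

lemma has_derivative_bilinear:
  fixes b :: "'e::euclidean_space \<Rightarrow> 'f::euclidean_space \<Rightarrow> 'c::real_normed_vector"
  assumes "bilinear b" "(X has_derivative X') (at x)" "(Y has_derivative Y') (at x)"
  shows "((\<lambda>y. b (X y) (Y y)) has_derivative (\<lambda>u. b (X x) (Y' u) + b (X' u) (Y x))) (at x)"
  using bounded_bilinear.FDERIV assms bilinear_conv_bounded_bilinear by blast

text \<open>Serves twice: for a chart of the product space inside the flat space, and for the
  hypersurface itself, which has codimension two there. \<open>\<beta>\<close> is Minkowskian in the
  hyperbolic case, so definiteness is demanded of the induced metric only.\<close>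

locale immersed_patch =
  fixes U :: "'a::euclidean_space set" and F :: "'a \<Rightarrow> 'e::euclidean_space"
    and \<beta> :: "'e \<Rightarrow> 'e \<Rightarrow> real" and G :: "'a \<Rightarrow> 'a \<Rightarrow> 'a \<Rightarrow> real"
  assumes open_U: "open U" and smooth: "smooth_on U F"
    and bilinear_ambient: "bilinear \<beta>" and ambient_commute: "\<beta> X Y = \<beta> Y X"
    and metric_eq: "x \<in> U \<Longrightarrow> G x u v = \<beta> (dir_deriv F x u) (dir_deriv F x v)"
    and metric_form: "x \<in> U \<Longrightarrow> inner_form (G x)"
begin

lemmas ambient_simps =
  bilinear_ladd[OF bilinear_ambient] bilinear_radd[OF bilinear_ambient] bilinear_lsub[OF bilinear_ambient]
  bilinear_rsub[OF bilinear_ambient] bilinear_lmul[OF bilinear_ambient] bilinear_rmul[OF bilinear_ambient]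
  bilinear_lneg[OF bilinear_ambient] bilinear_rneg[OF bilinear_ambient]
  bilinear_lzero[OF bilinear_ambient] bilinear_rzero[OF bilinear_ambient]

lemma linear_ambient: "linear (\<beta> X)"
  using bilinear_ambient by (simp add: bilinear_def)

lemma smooth_frame: "smooth_on U (\<lambda>x. dir_deriv F x u)"
  by (rule smooth_on_dir_deriv[OF smooth])

lemma linear_frame: "x \<in> U \<Longrightarrow> linear (dir_deriv F x)"
  by (rule smooth_on_linear_deriv[OF smooth])

lemma second_deriv_commute: "x \<in> U \<Longrightarrow> dir_deriv2 F x u v = dir_deriv2 F x v u"
  by (rule dir_deriv_symmetric[OF open_U _ smooth])

lemma has_derivative_metric:
  assumes "x \<in> U"
  shows "((\<lambda>y. G y v w) has_derivative
    (\<lambda>u. \<beta> (dir_deriv F x v) (dir_deriv2 F x u w) + \<beta> (dir_deriv2 F x u v) (dir_deriv F x w))) (at x)"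
  by (subst has_derivative_cong_open[OF open_U assms metric_eq], assumption)
    (intro has_derivative_bilinear bilinear_ambient smooth_on_has_derivative[OF smooth_frame assms])

text \<open>In the Koszul formula four of the six terms \<open>\<beta>(D\<^sup>2F, DF)\<close>
  cancel by symmetry of second derivatives, and the remaining two coincide.\<close>

lemma christoffel_eq:
  assumes "x \<in> U"
  shows "christoffel G x u v = sharp (G x) (\<lambda>w. \<beta> (dir_deriv2 F x u v) (dir_deriv F x w))"
proof -
  have "(dir_deriv (\<lambda>y. G y v w) x u + dir_deriv (\<lambda>y. G y u w) x v - dir_deriv (\<lambda>y. G y u v) x w) / 2
      = \<beta> (dir_deriv2 F x u v) (dir_deriv F x w)" for w
    using second_deriv_commute[OF assms, of u v] second_deriv_commute[OF assms, of u w]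
      second_deriv_commute[OF assms, of v w]
    by (simp add: dir_deriv_eq[OF has_derivative_metric[OF assms]] ambient_commute)
  then show ?thesis by (simp add: christoffel_def)
qed

lemma linear_ambient_frame:
  "x \<in> U \<Longrightarrow> linear (\<lambda>w. \<beta> X (dir_deriv F x w))"
  using linear_compose[OF linear_frame linear_ambient] by (simp add: o_def)

lemma metric_christoffel:
  assumes "x \<in> U"
  shows "G x (christoffel G x u v) w = \<beta> (dir_deriv2 F x u v) (dir_deriv F x w)"
  unfolding christoffel_eq[OF assms]
  by (rule inner_form.form_sharp[OF metric_form[OF assms] linear_ambient_frame[OF assms]])

lemma linear_christoffel:
  assumes x: "x \<in> U"
  shows "linear (christoffel G x u)"
proof -
  interpret inner_form "G x" by (rule metric_form[OF x])
  have lin: "linear (\<lambda>v. dir_deriv2 F x u v)" by (rule linear_dir_deriv2_right[OF open_U smooth x])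
  show ?thesis
    by (intro linearI eqI)
      (simp_all add: form_simps metric_christoffel[OF x] linear_add[OF lin] linear_cmul[OF lin] ambient_simps)
qed

lemma christoffel_differentiable:
  assumes "x \<in> U"
  shows "(\<lambda>y. christoffel G y u v) differentiable (at x)"
proof -
  have "(\<lambda>y. sharp (G y) (\<lambda>w. \<beta> (dir_deriv2 F y u v) (dir_deriv F y w))) differentiable (at x)"
  proof (rule differentiable_sharp[OF open_U assms metric_form])
    show "(\<lambda>y. G y u v) differentiable at x" for u v
      by (rule differentiableI[OF has_derivative_metric[OF assms]])
    show "(\<lambda>y. \<beta> (dir_deriv2 F y u v) (dir_deriv F y w)) differentiable at x" for w
      by (rule differentiableI[OF has_derivative_bilinear[OF bilinear_ambient
            smooth_on_has_derivative[OF smooth_on_dir_deriv[OF smooth_frame] assms]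
            smooth_on_has_derivative[OF smooth_frame assms]]])
  qed (auto intro: linear_ambient_frame)
  moreover have "(\<lambda>y. christoffel G y u v) differentiable (at x) \<longleftrightarrow>
      (\<lambda>y. sharp (G y) (\<lambda>w. \<beta> (dir_deriv2 F y u v) (dir_deriv F y w))) differentiable (at x)"
    by (rule differentiable_cong_open[OF open_U assms christoffel_eq])
  ultimately show ?thesis by blast
qed

lemma cov_deriv_const: "cov_deriv G (\<lambda>_. v) x u = christoffel G x u v"
  by (simp add: cov_deriv_def)

text \<open>The vector-valued second fundamental form of the patch in the flat space.\<close>

definition normal_part :: "'a \<Rightarrow> 'a \<Rightarrow> 'a \<Rightarrow> 'e" where
  "normal_part x u v = dir_deriv2 F x u v - dir_deriv F x (christoffel G x u v)"

lemma normal_part_orthogonal: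
  assumes "x \<in> U"
  shows "\<beta> (normal_part x u v) (dir_deriv F x w) = 0"
  using metric_christoffel[OF assms] metric_eq[OF assms]
  by (simp add: normal_part_def ambient_simps)

text \<open>
  The derivative of \<open>G(\<nabla>\<^sub>v w, z) = \<beta>(D\<^sup>2F(v, w), DF z)\<close>; its third-order term is symmetric in
  \<open>u\<close> and \<open>v\<close>, so it cancels in the curvature.
\<close>

lemma metric_cov_christoffel:
  assumes x: "x \<in> U"
  shows "G x (cov_deriv G (\<lambda>y. christoffel G y v w) x u) z =
    \<beta> (dir_deriv2 (\<lambda>y. dir_deriv F y w) x u v) (dir_deriv F x z) + \<beta> (normal_part x v w) (normal_part x u z)"
proof -
  let ?\<Gamma> = "\<lambda>y. christoffel G y v w"
  have \<Gamma>: "(?\<Gamma> has_derivative dir_deriv ?\<Gamma> x) (at x)"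
    by (rule has_derivative_dir_deriv[OF christoffel_differentiable[OF x]])
  have D1: "((\<lambda>y. \<beta> (dir_deriv F y (?\<Gamma> y)) (dir_deriv F y z)) has_derivative
      (\<lambda>u. \<beta> (dir_deriv F x (?\<Gamma> x)) (dir_deriv2 F x u z) +
        \<beta> (dir_deriv2 F x u (?\<Gamma> x) + dir_deriv F x (dir_deriv ?\<Gamma> x u)) (dir_deriv F x z))) (at x)"
  proof (rule has_derivative_bilinear[OF bilinear_ambient])
    show "((\<lambda>y. dir_deriv F y (?\<Gamma> y)) has_derivative
        (\<lambda>u. dir_deriv2 F x u (?\<Gamma> x) + dir_deriv F x (dir_deriv ?\<Gamma> x u))) (at x)"
      by (rule has_derivative_pushforward[OF open_U x _ open_U smooth has_derivative_ident \<Gamma>]) simp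
    show "((\<lambda>y. dir_deriv F y z) has_derivative (\<lambda>u. dir_deriv2 F x u z)) (at x)"
      by (rule smooth_on_has_derivative[OF smooth_frame x])
  qed
  have D2: "((\<lambda>y. \<beta> (dir_deriv2 F y v w) (dir_deriv F y z)) has_derivative
      (\<lambda>u. \<beta> (dir_deriv2 F x v w) (dir_deriv2 F x u z) +
        \<beta> (dir_deriv2 (\<lambda>y. dir_deriv F y w) x u v) (dir_deriv F x z))) (at x)"
    by (rule has_derivative_bilinear[OF bilinear_ambient
          smooth_on_has_derivative[OF smooth_on_dir_deriv[OF smooth_frame] x]
          smooth_on_has_derivative[OF smooth_frame x]])
  have "\<beta> (dir_deriv F y (?\<Gamma> y)) (dir_deriv F y z) = \<beta> (dir_deriv2 F y v w) (dir_deriv F y z)"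
    if "y \<in> U" for y
    using metric_christoffel[OF that] metric_eq[OF that] by simp
  then have D3: "frechet_derivative (\<lambda>y. \<beta> (dir_deriv F y (?\<Gamma> y)) (dir_deriv F y z)) (at x) =
      frechet_derivative (\<lambda>y. \<beta> (dir_deriv2 F y v w) (dir_deriv F y z)) (at x)"
    by (rule frechet_derivative_cong_open[OF open_U x])
  have "\<beta> (dir_deriv F x (?\<Gamma> x)) (dir_deriv2 F x u z) +
        \<beta> (dir_deriv2 F x u (?\<Gamma> x) + dir_deriv F x (dir_deriv ?\<Gamma> x u)) (dir_deriv F x z) =
      \<beta> (dir_deriv2 F x v w) (dir_deriv2 F x u z) +
        \<beta> (dir_deriv2 (\<lambda>y. dir_deriv F y w) x u v) (dir_deriv F x z)"
    using dir_deriv_eq[OF D1, of u] dir_deriv_eq[OF D2, of u] fun_cong[OF D3, of u] by simp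
  moreover have "G x (cov_deriv G ?\<Gamma> x u) z =
      \<beta> (dir_deriv2 F x u (?\<Gamma> x) + dir_deriv F x (dir_deriv ?\<Gamma> x u)) (dir_deriv F x z)"
    unfolding cov_deriv_def inner_form.form_simps[OF metric_form[OF x]] metric_christoffel[OF x]
    by (simp add: metric_eq[OF x] ambient_simps)
  moreover have "\<beta> (normal_part x v w) (normal_part x u z) = \<beta> (normal_part x v w) (dir_deriv2 F x u z)"
    using normal_part_orthogonal[OF x] by (simp add: normal_part_def[of x u z] ambient_simps)
  moreover have "\<beta> (normal_part x v w) (dir_deriv2 F x u z) =
      \<beta> (dir_deriv2 F x v w) (dir_deriv2 F x u z) - \<beta> (dir_deriv F x (?\<Gamma> x)) (dir_deriv2 F x u z)"
    by (simp add: normal_part_def ambient_simps)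
  ultimately show ?thesis by linarith
qed

lemma gauss_equation:
  assumes "x \<in> U"
  shows "G x (curvature G x u v w) z =
    \<beta> (normal_part x v w) (normal_part x u z) - \<beta> (normal_part x u w) (normal_part x v z)"
  unfolding curvature_def cov_deriv_const inner_form.form_simps[OF metric_form[OF assms]]
    metric_cov_christoffel[OF assms]
  using dir_deriv_symmetric[OF open_U assms smooth_frame] by simp

end

section \<open>Space forms times a line\<close>

lemma has_derivative_locally_const:
  assumes "(f has_derivative D) (at x)" "open S" "x \<in> S" "\<And>y. y \<in> S \<Longrightarrow> f y = c"
  shows "D u = 0"
proof -
  have "(f has_derivative (\<lambda>_. 0)) (at x)"
    by (rule has_derivative_transform_within_open[OF has_derivative_const[of c] assms(2,3)])
      (rule assms(4)[symmetric])
  then show ?thesis using has_derivative_unique[OF assms(1)] by simp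
qed

text \<open>The ambient form of the space-form factor alone; it is degenerate along the line, and it
  is the form through which the curvature of the product is expressed.\<close>

definition slice_form :: "real \<Rightarrow> ('a::euclidean_space \<times> real) \<times> real \<Rightarrow> ('a \<times> real) \<times> real \<Rightarrow> real"
  where "slice_form \<epsilon> X Y = space_form_ambient \<epsilon> (fst X) (fst Y)"

definition product_form :: "real \<Rightarrow> ('a::euclidean_space \<times> real) \<times> real \<Rightarrow> ('a \<times> real) \<times> real \<Rightarrow> real"
  where "product_form \<epsilon> X Y = slice_form \<epsilon> X Y + snd X * snd Y"

lemma space_form_times_line_eq:
  "space_form_times_line \<epsilon> = submanifold (product_form \<epsilon>) (space_form \<epsilon> \<times> UNIV)"
  by (simp add: space_form_times_line_def product_form_def[abs_def] slice_form_def)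

lemma bilinear_slice_form: "bilinear (slice_form \<epsilon>)"
  unfolding bilinear_def slice_form_def space_form_ambient_def
  by (auto intro!: linearI simp: inner_add_left inner_add_right algebra_simps)

lemma slice_form_commute: "slice_form \<epsilon> X Y = slice_form \<epsilon> Y X"
  by (auto simp: slice_form_def space_form_ambient_def inner_commute mult.commute)

lemmas slice_simps =
  bilinear_ladd[OF bilinear_slice_form] bilinear_radd[OF bilinear_slice_form]
  bilinear_lsub[OF bilinear_slice_form] bilinear_rsub[OF bilinear_slice_form]
  bilinear_lmul[OF bilinear_slice_form] bilinear_rmul[OF bilinear_slice_form]
  bilinear_lzero[OF bilinear_slice_form] bilinear_rzero[OF bilinear_slice_form]

lemma bilinear_product_form: "bilinear (product_form \<epsilon>)"
  unfolding bilinear_def product_form_def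
  by (intro conjI allI linearI) (simp_all add: slice_simps algebra_simps)

lemma product_form_commute: "product_form \<epsilon> X Y = product_form \<epsilon> Y X"
  by (simp add: product_form_def slice_form_commute[of \<epsilon> X Y] mult.commute)

lemmas product_simps =
  bilinear_ladd[OF bilinear_product_form] bilinear_radd[OF bilinear_product_form]
  bilinear_lmul[OF bilinear_product_form] bilinear_rmul[OF bilinear_product_form]

text \<open>For \<open>\<epsilon> = 0\<close> the model is a hyperplane through the origin, not a quadric.\<close>

definition model_tangent_space ::
    "real \<Rightarrow> ('a::euclidean_space \<times> real) \<times> real \<Rightarrow> (('a \<times> real) \<times> real) set"
  where "model_tangent_space \<epsilon> p = {X. if \<epsilon> = 0 then snd (fst X) = 0 else slice_form \<epsilon> X p = 0}"

lemma slice_form_position: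
  assumes "\<epsilon> \<in> {-1, 0, 1}" "\<epsilon> \<noteq> 0" "p \<in> space_form \<epsilon> \<times> UNIV"
  shows "slice_form \<epsilon> p p = \<epsilon>"
  using assms
  by (auto simp: slice_form_def space_form_ambient_def space_form_def power2_eq_square norm_eq_1)

lemma model_tangent_space_hyperplane:
  fixes p :: "('a::euclidean_space \<times> real) \<times> real"
  assumes "\<epsilon> \<in> {-1, 0, 1}" "p \<in> space_form \<epsilon> \<times> UNIV"
  shows "\<exists>a. a \<noteq> 0 \<and> model_tangent_space \<epsilon> p = {X. a \<bullet> X = 0}"
proof -
  consider "\<epsilon> = 0" | "\<epsilon> = 1" | "\<epsilon> = -1" using assms(1) by auto
  then show ?thesis
  proof cases
    case 1
    then show ?thesis
      by (intro exI[of _ "((0, 1), 0)"]) (auto simp: model_tangent_space_def inner_prod_def zero_prod_def)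
  next
    case 2
    then have "fst p \<noteq> 0" using assms(2) by (auto simp: space_form_def)
    then have "(fst p, 0::real) \<noteq> 0" by (simp add: zero_prod_def)
    with 2 show ?thesis
      by (intro exI[of _ "(fst p, 0)"])
        (auto simp: model_tangent_space_def slice_form_def space_form_ambient_def inner_prod_def[of "(fst p, 0)"]
          inner_commute)
  next
    case 3
    then have "snd (fst p) \<noteq> 0" using assms(2) by (auto simp: space_form_def)
    \<comment> \<open>Minkowski orthogonality to the position is Euclidean orthogonality to the
      vector with reversed time component, so the Euclidean dimension formula for hyperplanes
      applies.\<close>
    then have "((fst (fst p), - snd (fst p)), 0::real) \<noteq> 0" by (simp add: zero_prod_def)
    with 3 show ?thesis
      by (intro exI[of _ "((fst (fst p), - snd (fst p)), 0)"])
        (auto simp: model_tangent_space_def slice_form_def space_form_ambient_def inner_prod_def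
          inner_commute mult.commute)
  qed
qed

lemma model_tangent_space_dim:
  fixes p :: "('a::euclidean_space \<times> real) \<times> real"
  assumes "\<epsilon> \<in> {-1, 0, 1}" "p \<in> space_form \<epsilon> \<times> UNIV"
  shows "subspace (model_tangent_space \<epsilon> p)" "dim (model_tangent_space \<epsilon> p) = DIM('a \<times> real)"
  using model_tangent_space_hyperplane[OF assms] by (auto simp: subspace_hyperplane dim_hyperplane)

text \<open>The only delicate case is the hyperboloid, where tangent vectors have to be shown
  spacelike.\<close>

lemma product_form_pos:
  assumes "\<epsilon> \<in> {-1, 0, 1}" "p \<in> space_form \<epsilon> \<times> UNIV" "X \<in> model_tangent_space \<epsilon> p" "X \<noteq> 0"
  shows "product_form \<epsilon> X X > 0"
proof (cases "\<epsilon> = -1")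
  case False
  then have "product_form \<epsilon> X X = X \<bullet> X"
    by (simp add: product_form_def slice_form_def space_form_ambient_def inner_prod_def)
  then show ?thesis using assms(4) by simp
next
  case True
  obtain q t a where p: "p = ((q, t), a)" by (metis surj_pair)
  obtain x s r where X: "X = ((x, s), r)" by (metis surj_pair)
  have qt: "q \<bullet> q = t\<^sup>2 - 1" "t > 0" using assms(2) True by (auto simp: p space_form_def)
  have tang: "x \<bullet> q = s * t"
    using assms(3) True by (simp add: model_tangent_space_def slice_form_def space_form_ambient_def p X)
  \<comment> \<open>Cauchy-Schwarz for the space components, with tangency for the left side and the
    equation of the hyperboloid for the right side.\<close>
  have "(s * t)\<^sup>2 \<le> (x \<bullet> x) * (t\<^sup>2 - 1)"
    using Cauchy_Schwarz_ineq[of x q] by (simp add: tang qt)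
  then have ineq: "x \<bullet> x \<le> t\<^sup>2 * (x \<bullet> x - s\<^sup>2)" by (simp add: algebra_simps power_mult_distrib)
  have val: "product_form \<epsilon> X X = (x \<bullet> x - s\<^sup>2) + r\<^sup>2"
    using True by (simp add: product_form_def slice_form_def space_form_ambient_def X power2_eq_square)
  show ?thesis
  proof (cases "x = 0")
    case True
    then have "s = 0" using tang qt(2) by simp
    with True assms(4) X have "r \<noteq> 0" by (auto simp: zero_prod_def)
    then show ?thesis using val True \<open>s = 0\<close> by simp
  next
    case False
    then have "0 < t\<^sup>2 * (x \<bullet> x - s\<^sup>2)" using ineq by (meson inner_gt_zero_iff less_le_trans)
    then have "0 < x \<bullet> x - s\<^sup>2" using qt(2) by (simp add: zero_less_mult_iff)
    then show ?thesis using val by (simp add: add_pos_nonneg)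
  qed
qed

locale product_chart =
  fixes \<epsilon> :: real and d :: "(('a::euclidean_space \<times> real) \<times> real, 'a \<times> real) chart"
  assumes eps: "\<epsilon> \<in> {-1, 0, 1}" and chart: "d \<in> atlas (space_form_times_line \<epsilon>)"
begin

abbreviation "W \<equiv> chart_map d ` chart_dom d"
abbreviation "\<psi> \<equiv> chart_inv d"
abbreviation "h \<equiv> metric (space_form_times_line \<epsilon>) d"

text \<open>
  For \<open>\<epsilon> \<noteq> 0\<close> this is the normal vector of the model; for \<open>\<epsilon> = 0\<close> it is tangent, but every formula
  below multiplies it by \<open>\<epsilon>\<close>.
\<close>

definition position :: "'a \<times> real \<Rightarrow> ('a \<times> real) \<times> real"
  where "position y = (fst (\<psi> y), 0)"

lemma open_W: "open W" and smooth_param: "smooth_on W \<psi>"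
  and inj_param: "y \<in> W \<Longrightarrow> inj (dir_deriv \<psi> y)"
  and param_mem: "y \<in> W \<Longrightarrow> \<psi> y \<in> space_form \<epsilon> \<times> UNIV"
proof -
  have c: "openin (top_of_set (space_form \<epsilon> \<times> UNIV)) (chart_dom d)" "open W"
    "homeomorphism (chart_dom d) W (chart_map d) \<psi>" "smooth_on W \<psi>" "\<forall>y\<in>W. inj (dir_deriv \<psi> y)"
    using chart unfolding space_form_times_line_eq submanifold_def by auto
  show "open W" "smooth_on W \<psi>" by (rule c)+
  show "inj (dir_deriv \<psi> y)" if "y \<in> W" by (rule bspec[OF c(5) that])
  show "\<psi> y \<in> space_form \<epsilon> \<times> UNIV" if "y \<in> W"
  proof (rule subsetD[OF openin_imp_subset[OF c(1)]])
    have "\<psi> y \<in> \<psi> ` W" by (rule imageI[OF that])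
    then show "\<psi> y \<in> chart_dom d" unfolding homeomorphism_image2[OF c(3)] .
  qed
qed

lemma h_eq: "h y u v = product_form \<epsilon> (dir_deriv \<psi> y u) (dir_deriv \<psi> y v)"
  by (simp add: space_form_times_line_eq submanifold_def)

lemma linear_param: "y \<in> W \<Longrightarrow> linear (dir_deriv \<psi> y)"
  by (rule smooth_on_linear_deriv[OF smooth_param])

lemma tangent_position:
  assumes "\<epsilon> \<noteq> 0" "y \<in> W"
  shows "slice_form \<epsilon> (dir_deriv \<psi> y u) (\<psi> y) = 0"
proof -
  have "((\<lambda>y. slice_form \<epsilon> (\<psi> y) (\<psi> y)) has_derivative
      (\<lambda>u. slice_form \<epsilon> (\<psi> y) (dir_deriv \<psi> y u) + slice_form \<epsilon> (dir_deriv \<psi> y u) (\<psi> y))) (at y)"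
    by (intro has_derivative_bilinear bilinear_slice_form smooth_on_has_derivative[OF smooth_param assms(2)])
  from has_derivative_locally_const[OF this open_W assms(2) slice_form_position[OF eps assms(1) param_mem]]
  have "slice_form \<epsilon> (\<psi> y) (dir_deriv \<psi> y u) + slice_form \<epsilon> (dir_deriv \<psi> y u) (\<psi> y) = 0"
    by blast
  then show ?thesis by (simp add: slice_form_commute[of \<epsilon> "\<psi> y"])
qed

lemma tangent_flat:
  assumes "\<epsilon> = 0" "y \<in> W"
  shows "snd (fst (dir_deriv \<psi> y u)) = 0"
proof -
  have "((\<lambda>y. snd (fst (\<psi> y))) has_derivative (\<lambda>u. snd (fst (dir_deriv \<psi> y u)))) (at y)"
    by (intro has_derivative_snd has_derivative_fst smooth_on_has_derivative[OF smooth_param assms(2)])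
  moreover have "snd (fst (\<psi> y)) = 0" if "y \<in> W" for y
    using param_mem[OF that] assms(1) by (auto simp: space_form_def mem_Times_iff)
  ultimately show ?thesis
    by (rule has_derivative_locally_const[OF _ open_W assms(2)])
qed

text \<open>Differentiating the equation of the model gives one inclusion, and equality follows from
  the dimensions. Vectors of the flat space that are tangent to the model can thereby be pulled back
  to coordinates.\<close>

lemma range_param:
  assumes "y \<in> W"
  shows "range (dir_deriv \<psi> y) = model_tangent_space \<epsilon> (\<psi> y)"
proof (rule subspace_dim_equal)
  show "subspace (range (dir_deriv \<psi> y))"
    by (rule linear_subspace_image[OF linear_param[OF assms] subspace_UNIV])
  show "subspace (model_tangent_space \<epsilon> (\<psi> y))"
    by (rule model_tangent_space_dim[OF eps param_mem[OF assms]])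
  show "range (dir_deriv \<psi> y) \<subseteq> model_tangent_space \<epsilon> (\<psi> y)"
    using tangent_position[OF _ assms] tangent_flat[OF _ assms] by (auto simp: model_tangent_space_def)
  have "dim (range (dir_deriv \<psi> y)) = DIM('a \<times> real)"
    using dim_image_eq[OF linear_param[OF assms], of UNIV] inj_param[OF assms] by simp
  then show "dim (range (dir_deriv \<psi> y)) \<ge> dim (model_tangent_space \<epsilon> (\<psi> y))"
    using model_tangent_space_dim(2)[OF eps param_mem[OF assms]] by simp
qed

sublocale immersed_patch W \<psi> "product_form \<epsilon>" h
proof (rule immersed_patch.intro)
  show "open W" "smooth_on W \<psi>" by (rule open_W smooth_param)+
  show "bilinear (product_form \<epsilon>)" by (rule bilinear_product_form)
  show "product_form \<epsilon> X Y = product_form \<epsilon> Y X" for X Y by (rule product_form_commute)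
  show "h y u v = product_form \<epsilon> (dir_deriv \<psi> y u) (dir_deriv \<psi> y v)" for y u v by (rule h_eq)
  fix y assume y: "y \<in> W"
  have "bilinear (h y)"
    unfolding bilinear_def h_eq
    by (intro conjI allI linearI)
      (simp_all add: product_simps linear_add[OF linear_param[OF y]] linear_cmul[OF linear_param[OF y]])
  moreover have "h y u u > 0" if "u \<noteq> 0" for u
  proof -
    have "dir_deriv \<psi> y u \<noteq> 0"
      using inj_param[OF y] that linear_injective_0[OF linear_param[OF y]] by blast
    then show ?thesis
      unfolding h_eq using product_form_pos[OF eps param_mem[OF y]] range_param[OF y] by blast
  qed
  ultimately show "inner_form (h y)"
    by unfold_locales (auto simp: h_eq product_form_commute)
qed

lemma position_orthogonal:
  "y \<in> W \<Longrightarrow> \<epsilon> * product_form \<epsilon> (position y) (dir_deriv \<psi> y u) = 0"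
  using tangent_position[of y u] slice_form_commute[of \<epsilon> "\<psi> y" "dir_deriv \<psi> y u"]
  by (cases "\<epsilon> = 0") (simp_all add: product_form_def position_def slice_form_def)

text \<open>Gauss formula of the model. Differentiating the tangency condition shows that the
  right-hand side is tangent, so it is the image of some \<open>z\<close>; since the position is
  orthogonal to tangent vectors, \<open>z\<close> satisfies the characterisation of the Christoffel
  symbol.\<close>

lemma christoffel_image:
  assumes y: "y \<in> W"
  shows "dir_deriv \<psi> y (christoffel h y u v) = dir_deriv2 \<psi> y u v +
    (\<epsilon> * slice_form \<epsilon> (dir_deriv \<psi> y u) (dir_deriv \<psi> y v)) *\<^sub>R position y" (is "_ = ?X")
proof -
  have "?X \<in> model_tangent_space \<epsilon> (\<psi> y)"
  proof (cases "\<epsilon> = 0")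
    case True
    have "((\<lambda>y. snd (fst (dir_deriv \<psi> y v))) has_derivative (\<lambda>u. snd (fst (dir_deriv2 \<psi> y u v)))) (at y)"
      by (intro has_derivative_snd has_derivative_fst smooth_on_has_derivative[OF smooth_frame y])
    from has_derivative_locally_const[OF this open_W y tangent_flat[OF True]]
    have "snd (fst (dir_deriv2 \<psi> y u v)) = 0" by blast
    then show ?thesis by (simp add: model_tangent_space_def True)
  next
    case False
    have "((\<lambda>y. slice_form \<epsilon> (dir_deriv \<psi> y v) (\<psi> y)) has_derivative
        (\<lambda>u. slice_form \<epsilon> (dir_deriv \<psi> y v) (dir_deriv \<psi> y u) + slice_form \<epsilon> (dir_deriv2 \<psi> y u v) (\<psi> y))) (at y)"
      by (rule has_derivative_bilinear[OF bilinear_slice_form smooth_on_has_derivative[OF smooth_frame y]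
            smooth_on_has_derivative[OF smooth_param y]])
    from has_derivative_locally_const[OF this open_W y tangent_position[OF False]]
    have "slice_form \<epsilon> (dir_deriv \<psi> y v) (dir_deriv \<psi> y u) + slice_form \<epsilon> (dir_deriv2 \<psi> y u v) (\<psi> y) = 0"
      by blast
    moreover have "slice_form \<epsilon> (position y) (\<psi> y) = \<epsilon>"
      using slice_form_position[OF eps False param_mem[OF y]] by (simp add: slice_form_def position_def)
    moreover have "\<epsilon> = 1 \<or> \<epsilon> = -1" using eps False by auto
    ultimately show ?thesis
      by (auto simp: model_tangent_space_def slice_simps slice_form_commute[of _ "dir_deriv \<psi> y v"])
  qed
  then obtain z where z: "?X = dir_deriv \<psi> y z" using range_param[OF y] by blast
  have "h y (christoffel h y u v) w = h y z w" for w
    using position_orthogonal[OF y, of w]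
    unfolding metric_christoffel[OF y] h_eq[of y z] z[symmetric]
    by (auto simp: ambient_simps)
  then have "christoffel h y u v = z" by (rule inner_form.eqI[OF metric_form[OF y]])
  then show ?thesis using z by simp
qed

lemma position_norm:
  assumes "y \<in> W"
  shows "\<epsilon> * \<epsilon> * product_form \<epsilon> (position y) (position y) = \<epsilon>"
proof (cases "\<epsilon> = 0")
  case False
  then have "product_form \<epsilon> (position y) (position y) = \<epsilon>"
    using slice_form_position[OF eps False param_mem[OF assms]]
    by (simp add: product_form_def slice_form_def position_def)
  then show ?thesis using eps by auto
qed simp

text \<open>The Gauss equation with a second fundamental form proportional to the position: constant
  curvature \<epsilon> in the slices, no curvature along the line.\<close>

lemma curvature_eq:
  assumes y: "y \<in> W"
  shows "h y (curvature h y u v w) z =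
    \<epsilon> * (slice_form \<epsilon> (dir_deriv \<psi> y v) (dir_deriv \<psi> y w) * slice_form \<epsilon> (dir_deriv \<psi> y u) (dir_deriv \<psi> y z)
       - slice_form \<epsilon> (dir_deriv \<psi> y u) (dir_deriv \<psi> y w) * slice_form \<epsilon> (dir_deriv \<psi> y v) (dir_deriv \<psi> y z))"
proof -
  have n: "normal_part y u v = - (\<epsilon> * slice_form \<epsilon> (dir_deriv \<psi> y u) (dir_deriv \<psi> y v)) *\<^sub>R position y" for u v
    by (simp add: normal_part_def christoffel_image[OF y])
  have "product_form \<epsilon> (- (\<epsilon> * a) *\<^sub>R position y) (- (\<epsilon> * b) *\<^sub>R position y) = \<epsilon> * (a * b)" for a b
  proof -
    have "product_form \<epsilon> (- (\<epsilon> * a) *\<^sub>R position y) (- (\<epsilon> * b) *\<^sub>R position y) =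
        (\<epsilon> * \<epsilon> * product_form \<epsilon> (position y) (position y)) * (a * b)"
      unfolding ambient_simps by (simp add: mult_ac)
    then show ?thesis using position_norm[OF y] by simp
  qed
  then show ?thesis
    unfolding gauss_equation[OF y] n by (simp only: right_diff_distrib)
qed

lemma ex_vertical:
  assumes "y \<in> W"
  shows "\<exists>e. dir_deriv \<psi> y e = (0, 1)"
proof -
  have "(0, 1) \<in> model_tangent_space \<epsilon> (\<psi> y)"
    by (simp add: model_tangent_space_def slice_form_def space_form_ambient_def)
  then show ?thesis unfolding range_param[OF assms, symmetric] by (metis imageE)
qed

text \<open>Covariant derivatives along \<open>f\<close> become ordinary derivatives in the flat
  space, up to a multiple of the position. All later covariant derivatives of the normal and of the
  frame rest on this.\<close>

lemma pull_cov_image: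
  assumes S: "open S" "x \<in> S" "f ` S \<subseteq> W"
    and f: "f differentiable (at x)" and V: "V differentiable (at x)"
  shows "dir_deriv \<psi> (f x) (pull_cov h f V x u) = dir_deriv (\<lambda>y. dir_deriv \<psi> (f y) (V y)) x u +
    (\<epsilon> * slice_form \<epsilon> (dir_deriv \<psi> (f x) (dir_deriv f x u)) (dir_deriv \<psi> (f x) (V x))) *\<^sub>R position (f x)"
proof -
  have fx: "f x \<in> W" using S by blast
  have "dir_deriv (\<lambda>y. dir_deriv \<psi> (f y) (V y)) x u =
      dir_deriv2 \<psi> (f x) (dir_deriv f x u) (V x) + dir_deriv \<psi> (f x) (dir_deriv V x u)"
    by (rule dir_deriv_eq[OF has_derivative_pushforward[OF S open_W smooth_param
            has_derivative_dir_deriv[OF f] has_derivative_dir_deriv[OF V]]])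
  then show ?thesis
    by (simp add: pull_cov_def linear_add[OF linear_param[OF fx]] christoffel_image[OF fx])
qed

end

section \<open>Umbilical hypersurfaces in coordinates\<close>

text \<open>Umbilicity in one pair of charts. \<open>H\<close> enters as a bare function; its
  differentiability is proved below.\<close>

locale umbilical_patch = product_chart \<epsilon> d
  for \<epsilon> and d :: "(('a::euclidean_space \<times> real) \<times> real, 'a \<times> real) chart" +
  fixes U :: "'a set" and f :: "'a \<Rightarrow> 'a \<times> real" and \<eta> :: "'a \<Rightarrow> 'a \<times> real"
    and G :: "'a \<Rightarrow> 'a \<Rightarrow> 'a \<Rightarrow> real" and H :: "'a \<Rightarrow> real" and m :: real
  assumes dim: "DIM('a) \<ge> 2" and m: "m = real DIM('a)"
    and open_dom: "open U" and smooth_f: "smooth_on U f" and f_mem: "f ` U \<subseteq> W"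
    and smooth_normal: "smooth_on U \<eta>"
    and G_form: "x \<in> U \<Longrightarrow> inner_form (G x)"
    and G_eq: "x \<in> U \<Longrightarrow> G x u v = h (f x) (dir_deriv f x u) (dir_deriv f x v)"
    and normal_unit: "x \<in> U \<Longrightarrow> h (f x) (\<eta> x) (\<eta> x) = 1"
    and normal_orth: "x \<in> U \<Longrightarrow> h (f x) (\<eta> x) (dir_deriv f x u) = 0"
    and umbilical: "x \<in> U \<Longrightarrow>
      sharp (G x) (\<lambda>v. - h (f x) (pull_cov h f \<eta> x u) (dir_deriv f x v)) = H x *\<^sub>R u"
begin

abbreviation "B \<equiv> product_form \<epsilon>"

definition F :: "'a \<Rightarrow> ('a \<times> real) \<times> real" where "F x = \<psi> (f x)"
definition N :: "'a \<Rightarrow> ('a \<times> real) \<times> real" where "N x = dir_deriv \<psi> (f x) (\<eta> x)"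
text \<open>The last coordinate of \<open>F\<close> is the height function: \<open>t\<close> is its
  differential, \<open>T\<close> its gradient, and \<open>\<theta>\<close> the angle function of the
  hypersurface.\<close>

definition t :: "'a \<Rightarrow> 'a \<Rightarrow> real" where "t x u = snd (dir_deriv F x u)"
definition \<theta> :: "'a \<Rightarrow> real" where "\<theta> x = snd (N x)"
definition T :: "'a \<Rightarrow> 'a" where "T x = sharp (G x) (t x)"
definition s :: "'a \<Rightarrow> 'a \<Rightarrow> 'a \<Rightarrow> real" where "s x u v = G x u v - t x u * t x v"

lemma fx: "x \<in> U \<Longrightarrow> f x \<in> W"
  using f_mem by blast

lemma has_derivative_f: "x \<in> U \<Longrightarrow> (f has_derivative dir_deriv f x) (at x)"
  by (rule smooth_on_has_derivative[OF smooth_f])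

lemma smooth_F: "smooth_on U F"
  unfolding F_def[abs_def] by (rule smooth_on_compose[OF open_dom open_W f_mem smooth_f smooth_param])

lemma deriv_F: "x \<in> U \<Longrightarrow> dir_deriv F x u = dir_deriv \<psi> (f x) (dir_deriv f x u)"
  unfolding F_def[abs_def]
  by (rule dir_deriv_eq[OF has_derivative_compose[OF has_derivative_f smooth_on_has_derivative[OF smooth_param fx]]])

lemma has_derivative_frame: "x \<in> U \<Longrightarrow> ((\<lambda>y. dir_deriv F y v) has_derivative (\<lambda>u. dir_deriv2 F x u v)) (at x)"
  by (rule smooth_on_has_derivative[OF smooth_on_dir_deriv[OF smooth_F]])

lemma smooth_N: "smooth_on U N"
proof -
  have "smooth_on U (\<lambda>y. \<Sum>i\<in>Basis. (\<eta> y \<bullet> i) *\<^sub>R dir_deriv \<psi> (f y) i)"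
    by (intro smooth_on_sum smooth_on_bilinear[OF bounded_bilinear_scaleR] open_dom
        smooth_on_linear[OF bounded_linear_inner_left] smooth_normal
        smooth_on_compose[OF open_dom open_W f_mem smooth_f] smooth_on_dir_deriv smooth_param)
  moreover have "N y = (\<Sum>i\<in>Basis. (\<eta> y \<bullet> i) *\<^sub>R dir_deriv \<psi> (f y) i)" if "y \<in> U" for y
    unfolding N_def by (rule linear_basis_expansion[OF linear_param[OF fx[OF that]]])
  ultimately show ?thesis
    unfolding smooth_on_def using Ck_on_cong[OF open_dom] by (metis (no_types, lifting))
qed

lemma has_derivative_N: "x \<in> U \<Longrightarrow> (N has_derivative dir_deriv N x) (at x)"
  by (rule smooth_on_has_derivative[OF smooth_N])

sublocale M: immersed_patch U F B G
proof (rule immersed_patch.intro)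
  show "open U" "smooth_on U F" by (rule open_dom smooth_F)+
  show "bilinear B" by (rule bilinear_product_form)
  show "B X Y = B Y X" for X Y by (rule product_form_commute)
  show "G x u v = B (dir_deriv F x u) (dir_deriv F x v)" if "x \<in> U" for x u v
    by (simp add: G_eq[OF that] h_eq deriv_F[OF that])
  show "inner_form (G x)" if "x \<in> U" for x by (rule G_form[OF that])
qed

lemma linear_df: "x \<in> U \<Longrightarrow> linear (dir_deriv f x)"
  by (rule smooth_on_linear_deriv[OF smooth_f])

lemma inj_df: "x \<in> U \<Longrightarrow> inj (dir_deriv f x)"
  unfolding linear_injective_0[OF linear_df]
proof (intro allI impI)
  fix u assume "x \<in> U" "dir_deriv f x u = 0"
  then have "G x u u = 0" by (simp add: G_eq inner_form.form_simps[OF metric_form[OF fx]])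
  then show "u = 0" using inner_form.zero_iff[OF G_form[OF \<open>x \<in> U\<close>]] by simp
qed

lemma N_unit: "x \<in> U \<Longrightarrow> B (N x) (N x) = 1"
  using normal_unit[of x] by (simp add: h_eq N_def)

lemma N_orth: "x \<in> U \<Longrightarrow> B (N x) (dir_deriv F x u) = 0"
  using normal_orth[of x u] by (simp add: h_eq N_def deriv_F)

lemma position_orth:
  assumes "x \<in> U"
  shows "\<epsilon> * B (position (f x)) (dir_deriv F x u) = 0" "\<epsilon> * B (position (f x)) (N x) = 0"
  using position_orthogonal[OF fx[OF assms]] by (auto simp: deriv_F[OF assms] N_def)

lemma normal_component:
  assumes "x \<in> U" "\<And>w. h (f x) X (dir_deriv f x w) = 0"
  shows "X = h (f x) X (\<eta> x) *\<^sub>R \<eta> x"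
  by (rule orthogonal_complement_decomp[OF metric_form[OF fx] _ linear_df inj_df normal_unit normal_orth])
    (simp_all add: assms)

lemma slice_frame: "x \<in> U \<Longrightarrow> slice_form \<epsilon> (dir_deriv F x u) (dir_deriv F x v) = s x u v"
  by (simp add: s_def M.metric_eq product_form_def t_def)

lemma slice_normal: "x \<in> U \<Longrightarrow> slice_form \<epsilon> (N x) (dir_deriv F x v) = - \<theta> x * t x v"
  using N_orth[of x v] by (simp add: product_form_def t_def \<theta>_def)

lemma pull_cov_normal_image:
  assumes x: "x \<in> U"
  shows "dir_deriv \<psi> (f x) (pull_cov h f \<eta> x u) = dir_deriv N x u - (\<epsilon> * (\<theta> x * t x u)) *\<^sub>R position (f x)"
  using pull_cov_image[OF open_dom x f_mem smooth_on_differentiable[OF smooth_f x]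
      smooth_on_differentiable[OF smooth_normal x], of u] slice_normal[OF x, of u]
  by (simp add: N_def[abs_def] deriv_F[OF x] slice_form_commute[of \<epsilon> _ "dir_deriv \<psi> (f x) (\<eta> x)"])

text \<open>Weingarten formula. \<open>umbilical\<close> determines the tangential part, the unit
  length of the normal removes its own component, and in codimension one nothing else is
  left.\<close>

lemma pull_cov_normal:
  assumes x: "x \<in> U"
  shows "pull_cov h f \<eta> x u = - H x *\<^sub>R dir_deriv f x u"
proof -
  interpret h: inner_form "h (f x)" by (rule metric_form[OF fx[OF x]])
  interpret G: inner_form "G x" by (rule G_form[OF x])
  let ?P = "pull_cov h f \<eta> x u"
  have "linear (\<lambda>v. - h (f x) ?P (dir_deriv f x v))"
    using linear_compose[OF linear_df[OF x] h.linear_right, of ?P]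
    by (simp add: o_def linear_compose_neg)
  from G.form_sharp[OF this]
  have "- h (f x) ?P (dir_deriv f x w) = H x * G x u w" for w
    unfolding umbilical[OF x] by (simp add: G.form_simps)
  then have tang: "h (f x) (?P + H x *\<^sub>R dir_deriv f x u) (dir_deriv f x w) = 0" for w
    by (smt (verit) G_eq[OF x] h.form_simps real_scaleR_def)
  have "((\<lambda>y. B (N y) (N y)) has_derivative (\<lambda>u. B (N x) (dir_deriv N x u) + B (dir_deriv N x u) (N x))) (at x)"
    by (rule has_derivative_bilinear[OF bilinear_product_form has_derivative_N[OF x] has_derivative_N[OF x]])
  from has_derivative_locally_const[OF this open_dom x N_unit, of u]
  have "B (dir_deriv N x u) (N x) = 0" by (simp add: product_form_commute)
  then have "h (f x) ?P (\<eta> x) = 0"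
    using position_orth(2)[OF x]
    by (auto simp: h_eq pull_cov_normal_image[OF x] N_def[symmetric] M.ambient_simps)
  then have "h (f x) (?P + H x *\<^sub>R dir_deriv f x u) (\<eta> x) = 0"
    using normal_orth[OF x, of u] by (simp add: h.form_simps h.commute)
  then have "?P + H x *\<^sub>R dir_deriv f x u = 0"
    using normal_component[OF x tang] by simp
  then show ?thesis by (simp add: eq_neg_iff_add_eq_0)
qed

lemma deriv_N:
  assumes x: "x \<in> U"
  shows "dir_deriv N x u = - H x *\<^sub>R dir_deriv F x u + (\<epsilon> * (\<theta> x * t x u)) *\<^sub>R position (f x)"
  using pull_cov_normal_image[OF x, of u] linear_cmul[OF linear_param[OF fx[OF x]]]
  by (simp add: pull_cov_normal[OF x] deriv_F[OF x] linear_neg[OF linear_param[OF fx[OF x]]] algebra_simps)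

text \<open>The position has no component along the line, so only the shape-operator term of
  \<open>deriv_N\<close> survives.\<close>

lemma deriv_\<theta>:
  assumes x: "x \<in> U"
  shows "(\<theta> has_derivative (\<lambda>u. - H x * t x u)) (at x)"
proof -
  have "((\<lambda>y. snd (N y)) has_derivative (\<lambda>u. snd (dir_deriv N x u))) (at x)"
    by (intro has_derivative_snd has_derivative_N x)
  then show ?thesis
    by (simp add: deriv_N[OF x] t_def \<theta>_def[abs_def] position_def)
qed

lemma has_derivative_t: "x \<in> U \<Longrightarrow> ((\<lambda>y. t y v) has_derivative (\<lambda>u. snd (dir_deriv2 F x u v))) (at x)"
  unfolding t_def by (intro has_derivative_snd has_derivative_frame)

lemma linear_t: "x \<in> U \<Longrightarrow> linear (t x)"
  unfolding t_def using linear_compose[OF M.linear_frame linear_snd] by (simp add: o_def)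

lemma pull_cov_frame_image:
  assumes x: "x \<in> U"
  shows "dir_deriv \<psi> (f x) (pull_cov h f (\<lambda>y. dir_deriv f y v) x u) =
    dir_deriv2 F x u v + (\<epsilon> * s x u v) *\<^sub>R position (f x)"
proof -
  have "dir_deriv (\<lambda>y. dir_deriv \<psi> (f y) (dir_deriv f y v)) x u = dir_deriv2 F x u v"
    by (rule fun_cong[OF frechet_derivative_cong_open[OF open_dom x]]) (rule deriv_F[symmetric])
  then show ?thesis
    using pull_cov_image[OF open_dom x f_mem smooth_on_differentiable[OF smooth_f x]
        smooth_on_differentiable[OF smooth_on_dir_deriv[OF smooth_f] x], of v u] slice_frame[OF x, of u v]
    by (simp add: deriv_F[OF x])
qed

text \<open>The tangential part is cancelled by the Christoffel term; differentiating
  \<open>N_orth\<close> expresses the normal component through \<open>deriv_N\<close>.\<close>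

lemma second_fform_eq:
  assumes x: "x \<in> U"
  shows "second_fform G h f x u v = (H x * G x u v) *\<^sub>R \<eta> x"
proof -
  interpret h: inner_form "h (f x)" by (rule metric_form[OF fx[OF x]])
  let ?S = "second_fform G h f x u v"
  have S: "dir_deriv \<psi> (f x) ?S = M.normal_part x u v + (\<epsilon> * s x u v) *\<^sub>R position (f x)"
    by (simp add: second_fform_def linear_diff[OF linear_param[OF fx[OF x]]] pull_cov_frame_image[OF x]
        M.normal_part_def M.cov_deriv_const deriv_F[OF x])
  have tang: "h (f x) ?S (dir_deriv f x w) = 0" for w
    using position_orth(1)[OF x, of w] M.normal_part_orthogonal[OF x, of u v w]
    by (auto simp: h_eq S M.ambient_simps deriv_F[OF x, symmetric])
  have "((\<lambda>y. B (N y) (dir_deriv F y v)) has_derivative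
      (\<lambda>u. B (N x) (dir_deriv2 F x u v) + B (dir_deriv N x u) (dir_deriv F x v))) (at x)"
    by (rule has_derivative_bilinear[OF bilinear_product_form has_derivative_N[OF x] has_derivative_frame[OF x]])
  from has_derivative_locally_const[OF this open_dom x N_orth, of u]
  have "B (N x) (dir_deriv2 F x u v) = H x * G x u v"
    using position_orth(1)[OF x, of v] by (auto simp: deriv_N[OF x] M.ambient_simps M.metric_eq[OF x])
  then have "h (f x) ?S (\<eta> x) = H x * G x u v"
    using position_orth(2)[OF x] N_orth[OF x]
    by (auto simp: h_eq S M.normal_part_def M.ambient_simps N_def[symmetric] product_form_commute[of \<epsilon> _ "N x"])
  then show ?thesis using normal_component[OF x tang] by simp
qed

text \<open>Second fundamental form in the flat space, split along the hypersurface normal and the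
  position; the Gauss equation for M is read off from it.\<close>

lemma normal_part_eq:
  assumes x: "x \<in> U"
  shows "M.normal_part x u v = (H x * G x u v) *\<^sub>R N x - (\<epsilon> * s x u v) *\<^sub>R position (f x)"
proof -
  have "dir_deriv \<psi> (f x) (second_fform G h f x u v) = M.normal_part x u v + (\<epsilon> * s x u v) *\<^sub>R position (f x)"
    by (simp add: second_fform_def linear_diff[OF linear_param[OF fx[OF x]]] pull_cov_frame_image[OF x]
        M.normal_part_def M.cov_deriv_const deriv_F[OF x])
  then show ?thesis
    by (simp add: second_fform_eq[OF x] linear_cmul[OF linear_param[OF fx[OF x]]] N_def)
qed

section \<open>Differentiability of H, the Codazzi equation and the length of T\<close>

text \<open>Testing the Weingarten formula on a fixed nonzero vector \<open>b\<close> writes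
  \<open>H\<close> as a quotient of differentiable functions.\<close>

lemma H_differentiable:
  assumes x: "x \<in> U"
  shows "H differentiable (at x)"
proof -
  obtain b :: 'a where b: "b \<noteq> 0" using nonempty_Basis nonzero_Basis by blast
  have pos: "G y b b \<noteq> 0" if "y \<in> U" for y
    using inner_form.zero_iff[OF G_form[OF that]] b by blast
  have "H y = - B (dir_deriv N y b) (dir_deriv F y b) / G y b b" if y: "y \<in> U" for y
    using pos[OF y] position_orth(1)[OF y, of b]
    by (auto simp: deriv_N[OF y] M.ambient_simps M.metric_eq[OF y])
  then have "H differentiable (at x) \<longleftrightarrow>
      (\<lambda>y. - B (dir_deriv N y b) (dir_deriv F y b) / G y b b) differentiable (at x)"
    by (rule differentiable_cong_open[OF open_dom x])
  moreover have "(\<lambda>y. B (dir_deriv N y b) (dir_deriv F y b)) differentiable (at x)"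
    by (rule differentiableI[OF has_derivative_bilinear[OF bilinear_product_form
          smooth_on_has_derivative[OF smooth_on_dir_deriv[OF smooth_N] x] has_derivative_frame[OF x]]])
  moreover have "(\<lambda>y. G y b b) differentiable (at x)"
    by (rule differentiableI[OF M.has_derivative_metric[OF x]])
  ultimately show ?thesis using pos[OF x] by (simp add: differentiable_divide)
qed

text \<open>In dimension at least two some nonzero \<open>w\<close> is orthogonal to
  \<open>u\<close>; pairing the identity with \<open>w\<close> removes its right-hand side.\<close>

lemma linear_dual_zero:
  fixes a :: "'a \<Rightarrow> real"
  assumes "linear a" "\<And>u w. a u *\<^sub>R w = a w *\<^sub>R u"
  shows "a u = 0"
proof -
  obtain w where w: "w \<noteq> 0" "u \<bullet> w = 0"
    using orthogonal_to_vector_exists[OF dim, of u] by (auto simp: orthogonal_def)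
  have "a u * (w \<bullet> w) = a w * (u \<bullet> w)"
    using arg_cong[OF assms(2)[of u w], of "\<lambda>z. z \<bullet> w"] by simp
  then show ?thesis using w by simp
qed

text \<open>Compares the two orders of differentiation of the normal field in the flat space; the
  second derivatives of \<open>F\<close> are symmetric and drop out.\<close>

lemma codazzi:
  assumes x: "x \<in> U"
  shows "(H has_derivative (\<lambda>u. - \<epsilon> * \<theta> x * t x u)) (at x)"
proof -
  define c where "c = \<epsilon> * \<theta> x"
  have HD: "(H has_derivative dir_deriv H x) (at x)"
    by (rule has_derivative_dir_deriv[OF H_differentiable[OF x]])
  have P: "((\<lambda>y. position (f y)) has_derivative (\<lambda>w. (fst (dir_deriv F x w), 0))) (at x)"
    unfolding position_def F_def[symmetric]
    by (intro has_derivative_Pair has_derivative_fst has_derivative_const smooth_on_has_derivative[OF smooth_F x])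
  have D: "dir_deriv2 N x w u = - H x *\<^sub>R dir_deriv2 F x w u - dir_deriv H x w *\<^sub>R dir_deriv F x u
      + (\<epsilon> * (\<theta> x * snd (dir_deriv2 F x w u) - H x * t x w * t x u)) *\<^sub>R position (f x)
      + (c * t x u) *\<^sub>R (fst (dir_deriv F x w), 0)" for u w
  proof -
    have "dir_deriv2 N x w u =
        dir_deriv (\<lambda>y. - H y *\<^sub>R dir_deriv F y u + (\<epsilon> * (\<theta> y * t y u)) *\<^sub>R position (f y)) x w"
      by (rule fun_cong[OF frechet_derivative_cong_open[OF open_dom x]]) (rule deriv_N)
    also have "\<dots> = - H x *\<^sub>R dir_deriv2 F x w u + - dir_deriv H x w *\<^sub>R dir_deriv F x u
        + ((\<epsilon> * (\<theta> x * t x u)) *\<^sub>R (fst (dir_deriv F x w), 0)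
          + (\<epsilon> * (\<theta> x * snd (dir_deriv2 F x w u) + - H x * t x w * t x u)) *\<^sub>R position (f x))"
      by (rule dir_deriv_eq, rule has_derivative_add, rule has_derivative_scaleR,
          rule has_derivative_minus[OF HD], rule has_derivative_frame[OF x],
          rule has_derivative_scaleR, rule has_derivative_mult_right,
          rule has_derivative_mult[OF deriv_\<theta>[OF x] has_derivative_t[OF x]], rule P)
    finally show ?thesis by (simp add: c_def algebra_simps)
  qed
  have sym: "dir_deriv2 N x w u = dir_deriv2 N x u w" for u w
    by (rule dir_deriv_symmetric[OF open_dom x smooth_N])
  \<comment> \<open>With \<open>e\<close> the vertical unit vector, the horizontal part of a frame
    vector is that vector minus a multiple of \<open>e\<close>, and the \<open>e\<close>-terms are
    symmetric in \<open>u\<close> and \<open>w\<close>. Obtaining \<open>e\<close> keeps it opaque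
    to the simplifier.\<close>
  obtain e :: "('a \<times> real) \<times> real" where split: "\<And>X. (fst X, 0) = X - snd X *\<^sub>R e"
    using that[of "(0, 1)"] by (simp add: prod_eq_iff)
  \<comment> \<open>The one-form whose vanishing is the Codazzi equation.\<close>
  define a where "a u = dir_deriv H x u + c * t x u" for u
  have "a u *\<^sub>R dir_deriv F x w = a w *\<^sub>R dir_deriv F x u" for u w
  proof -
    have "dir_deriv2 N x w u - dir_deriv2 N x u w = 0" using sym by simp
    then show ?thesis
      unfolding D a_def split M.second_deriv_commute[OF x, of w u]
      by (simp add: t_def[symmetric] algebra_simps)
  qed
  then have "dir_deriv F x (a u *\<^sub>R w) = dir_deriv F x (a w *\<^sub>R u)" for u w
    by (simp add: linear_cmul[OF M.linear_frame[OF x]])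
  then have "a u *\<^sub>R w = a w *\<^sub>R u" for u w
    unfolding deriv_F[OF x] using inj_param[OF fx[OF x]] inj_df[OF x] by (meson injD)
  moreover have "linear a"
    unfolding a_def using linear_t[OF x] linear_dir_deriv[OF H_differentiable[OF x]]
    by (intro linearI) (auto simp: linear_add linear_cmul algebra_simps)
  ultimately have "a u = 0" for u by (intro linear_dual_zero)
  then have "dir_deriv H x u = - \<epsilon> * \<theta> x * t x u" for u
    by (simp add: a_def c_def eq_neg_iff_add_eq_0)
  then have "dir_deriv H x = (\<lambda>u. - \<epsilon> * \<theta> x * t x u)" by blast
  with HD show ?thesis by simp
qed

lemma G_T: "x \<in> U \<Longrightarrow> G x (T x) w = t x w"
  unfolding T_def by (rule inner_form.form_sharp[OF G_form linear_t])

text \<open>The vertical unit field is tangent to the model and equals T plus \<theta> times the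
  unit normal; its length 1 gives the identity.\<close>

lemma t_T:
  assumes x: "x \<in> U"
  shows "t x (T x) = 1 - (\<theta> x)\<^sup>2"
proof -
  interpret h: inner_form "h (f x)" by (rule metric_form[OF fx[OF x]])
  obtain e where e: "dir_deriv \<psi> (f x) e = (0, 1)" using ex_vertical[OF fx[OF x]] by blast
  have Z: "slice_form \<epsilon> (0, 1) X = 0" for X
    by (simp add: slice_form_def space_form_ambient_def)
  have et: "h (f x) e (dir_deriv f x w) = t x w" for w
    by (simp add: h_eq e product_form_def Z t_def deriv_F[OF x])
  have ee: "h (f x) e e = 1" by (simp add: h_eq e product_form_def Z)
  have en: "h (f x) e (\<eta> x) = \<theta> x" by (simp add: h_eq e product_form_def Z \<theta>_def N_def)
  have "e - dir_deriv f x (T x) = h (f x) (e - dir_deriv f x (T x)) (\<eta> x) *\<^sub>R \<eta> x"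
    by (rule normal_component[OF x]) (simp add: h.form_simps et G_eq[OF x, symmetric] G_T[OF x])
  also have "h (f x) (e - dir_deriv f x (T x)) (\<eta> x) = \<theta> x"
    using normal_orth[OF x] by (simp add: h.form_simps en h.commute[of _ "\<eta> x"])
      (simp add: h.commute en)
  finally have "e = dir_deriv f x (T x) + \<theta> x *\<^sub>R \<eta> x" by (simp add: algebra_simps)
  then have "h (f x) e e = h (f x) e (dir_deriv f x (T x) + \<theta> x *\<^sub>R \<eta> x)" by simp
  then show ?thesis by (simp add: h.form_simps ee et en power2_eq_square)
qed

section \<open>The tension field and its covariant derivatives\<close>

lemma pull_cov_scaleR:
  assumes x: "x \<in> U" and a: "(a has_derivative a') (at x)" and V: "V differentiable (at x)"
  shows "pull_cov h f (\<lambda>y. a y *\<^sub>R V y) x u = a' u *\<^sub>R V x + a x *\<^sub>R pull_cov h f V x u"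
  using dir_deriv_eq[OF has_derivative_scaleR[OF a has_derivative_dir_deriv[OF V]], of u]
    linear_cmul[OF linear_christoffel[OF fx[OF x]]]
  by (simp add: pull_cov_def scaleR_add_right)

lemma pull_cov_add:
  assumes x: "x \<in> U" and V: "V differentiable (at x)" "V' differentiable (at x)"
  shows "pull_cov h f (\<lambda>y. V y + V' y) x u = pull_cov h f V x u + pull_cov h f V' x u"
  using dir_deriv_eq[OF has_derivative_add[OF V[THEN has_derivative_dir_deriv]], of u]
    linear_add[OF linear_christoffel[OF fx[OF x]]]
  by (simp add: pull_cov_def)

lemma pull_cov_cong:
  assumes x: "x \<in> U" and "\<And>y. y \<in> U \<Longrightarrow> V y = V' y"
  shows "pull_cov h f V x u = pull_cov h f V' x u"
proof -
  have "frechet_derivative V (at x) = frechet_derivative V' (at x)"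
    by (rule frechet_derivative_cong_open[OF open_dom assms])
  then show ?thesis by (simp add: pull_cov_def assms(2)[OF x])
qed

lemma differentiable_normal: "x \<in> U \<Longrightarrow> \<eta> differentiable (at x)"
  by (rule smooth_on_differentiable[OF smooth_normal])

lemma differentiable_frame: "x \<in> U \<Longrightarrow> (\<lambda>y. dir_deriv f y v) differentiable (at x)"
  by (rule smooth_on_differentiable[OF smooth_on_dir_deriv[OF smooth_f]])

lemma pull_cov_frame:
  "x \<in> U \<Longrightarrow> pull_cov h f (\<lambda>y. dir_deriv f y v) x u =
    (H x * G x u v) *\<^sub>R \<eta> x + dir_deriv f x (christoffel G x u v)"
  using second_fform_eq[of x u v] by (simp add: second_fform_def M.cov_deriv_const diff_eq_eq)

lemma tension_eq:
  assumes x: "x \<in> U"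
  shows "tension G h f x = (m * H x) *\<^sub>R \<eta> x"
proof -
  have "second_fform G h f x = (\<lambda>u v. (H x * G x u v) *\<^sub>R \<eta> x)"
    by (intro ext second_fform_eq x)
  then show ?thesis
    using inner_form.metric_trace_self[OF G_form[OF x]]
    by (simp add: m tension_def metric_trace_scaleR_left metric_trace_mult)
qed

lemma has_derivative_H_sq:
  "x \<in> U \<Longrightarrow> ((\<lambda>y. (H y)\<^sup>2) has_derivative (\<lambda>u. - 2 * \<epsilon> * \<theta> x * H x * t x u)) (at x)"
  by (rule has_derivative_eq_rhs[OF has_derivative_power[OF codazzi]]) (auto simp: fun_eq_iff)

lemma pull_cov_tension:
  assumes x: "x \<in> U"
  shows "pull_cov h f (tension G h f) x u =
    (- m * \<epsilon> * (\<theta> x * t x u)) *\<^sub>R \<eta> x + (- m * (H x)\<^sup>2) *\<^sub>R dir_deriv f x u"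
proof -
  have "pull_cov h f (tension G h f) x u = pull_cov h f (\<lambda>y. (m * H y) *\<^sub>R \<eta> y) x u"
    by (rule pull_cov_cong[OF x tension_eq])
  also have "\<dots> = (m * (- \<epsilon> * \<theta> x * t x u)) *\<^sub>R \<eta> x + (m * H x) *\<^sub>R pull_cov h f \<eta> x u"
    by (rule pull_cov_scaleR[OF x has_derivative_mult_right[OF codazzi[OF x]] differentiable_normal[OF x]])
  finally show ?thesis by (simp add: pull_cov_normal[OF x] power2_eq_square mult_ac)
qed

text \<open>Of the two tangential terms, the simple one comes from differentiating the unit normal
  and the double one from differentiating \<open>(H y)\<^sup>2\<close>. After tracing they add up to
  the factor 3 in the Laplacian.\<close>

lemma pull_cov2_tension:
  assumes x: "x \<in> U"
  shows "pull_cov h f (\<lambda>y. pull_cov h f (tension G h f) y v) x u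
      - pull_cov h f (tension G h f) x (christoffel G x u v) =
    (- m * \<epsilon> * (\<theta> x * snd (dir_deriv2 F x u v) - H x * t x u * t x v - \<theta> x * t x (christoffel G x u v))
      - m * H x ^ 3 * G x u v) *\<^sub>R \<eta> x
    + (m * \<epsilon> * \<theta> x * H x) *\<^sub>R (t x v *\<^sub>R dir_deriv f x u)
    + (2 * m * \<epsilon> * \<theta> x * H x) *\<^sub>R (t x u *\<^sub>R dir_deriv f x v)"
proof -
  have c: "((\<lambda>y. - m * \<epsilon> * (\<theta> y * t y v)) has_derivative
      (\<lambda>u. - m * \<epsilon> * (\<theta> x * snd (dir_deriv2 F x u v) + - H x * t x u * t x v))) (at x)"
    by (intro has_derivative_mult_right has_derivative_mult[OF deriv_\<theta>[OF x] has_derivative_t[OF x]])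
  have e: "((\<lambda>y. - m * (H y)\<^sup>2) has_derivative (\<lambda>u. - m * (- 2 * \<epsilon> * \<theta> x * H x * t x u))) (at x)"
    by (intro has_derivative_mult_right has_derivative_H_sq x)
  have "pull_cov h f (\<lambda>y. pull_cov h f (tension G h f) y v) x u =
      pull_cov h f (\<lambda>y. (- m * \<epsilon> * (\<theta> y * t y v)) *\<^sub>R \<eta> y + (- m * (H y)\<^sup>2) *\<^sub>R dir_deriv f y v) x u"
    by (rule pull_cov_cong[OF x pull_cov_tension])
  also have "\<dots> = pull_cov h f (\<lambda>y. (- m * \<epsilon> * (\<theta> y * t y v)) *\<^sub>R \<eta> y) x u +
      pull_cov h f (\<lambda>y. (- m * (H y)\<^sup>2) *\<^sub>R dir_deriv f y v) x u"
    by (rule pull_cov_add[OF x])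
      (rule differentiable_scaleR differentiableI[OF c] differentiableI[OF e]
        differentiable_normal[OF x] differentiable_frame[OF x])+
  also have "\<dots> = (- m * \<epsilon> * (\<theta> x * snd (dir_deriv2 F x u v) + - H x * t x u * t x v)) *\<^sub>R \<eta> x
      + (- m * \<epsilon> * (\<theta> x * t x v)) *\<^sub>R (- H x *\<^sub>R dir_deriv f x u)
      + ((- m * (- 2 * \<epsilon> * \<theta> x * H x * t x u)) *\<^sub>R dir_deriv f x v
      + (- m * (H x)\<^sup>2) *\<^sub>R ((H x * G x u v) *\<^sub>R \<eta> x + dir_deriv f x (christoffel G x u v)))"
    by (simp only: pull_cov_scaleR[OF x c differentiable_normal[OF x]]
        pull_cov_scaleR[OF x e differentiable_frame[OF x]] pull_cov_normal[OF x] pull_cov_frame[OF x])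
  finally show ?thesis
    unfolding pull_cov_tension[OF x] by (simp add: algebra_simps power2_eq_square power3_eq_cube)
qed

section \<open>Intrinsic curvature of the hypersurface\<close>

text \<open>The unit normal contributes a constant-curvature tensor with factor
  \<open>(H x)\<^sup>2\<close>, the position one built from \<open>s\<close> with factor \<epsilon>.
  Raising the index of \<open>s x u\<close> gives \<open>u - t x u *\<^sub>R T x\<close>.\<close>

lemma curvature_M:
  assumes x: "x \<in> U"
  shows "curvature G x u v w =
    (H x)\<^sup>2 *\<^sub>R (G x v w *\<^sub>R u - G x u w *\<^sub>R v)
    + \<epsilon> *\<^sub>R (s x v w *\<^sub>R (u - t x u *\<^sub>R T x) - s x u w *\<^sub>R (v - t x v *\<^sub>R T x))" (is "_ = ?R")
proof -
  interpret G: inner_form "G x" by (rule G_form[OF x])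
  have PP: "\<epsilon> * (\<epsilon> * B (position (f x)) (position (f x))) = \<epsilon>"
    using position_norm[OF fx[OF x]] by simp
  have n: "B (M.normal_part x a b) (M.normal_part x c d) =
      (H x)\<^sup>2 * (G x a b * G x c d) + \<epsilon> * (s x a b * s x c d)" for a b c d
  proof -
    have "B (M.normal_part x a b) (M.normal_part x c d) = (H x * G x a b) * (H x * G x c d) * B (N x) (N x)
        - (\<epsilon> * B (position (f x)) (N x)) * (s x a b * (H x * G x c d) + s x c d * (H x * G x a b))
        + (\<epsilon> * (\<epsilon> * B (position (f x)) (position (f x)))) * (s x a b * s x c d)"
      unfolding normal_part_eq[OF x] M.ambient_simps product_form_commute[of \<epsilon> "N x" "position (f x)"]
      by (simp add: algebra_simps)
    then show ?thesis
      unfolding PP N_unit[OF x] position_orth(2)[OF x] by (simp add: power2_eq_square)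
  qed
  show ?thesis
  proof (rule G.eqI)
    fix z
    show "G x (curvature G x u v w) z = G x ?R z"
      unfolding M.gauss_equation[OF x] n
      by (simp add: G.form_simps G_T[OF x] s_def[of x _ z] algebra_simps)
  qed
qed

definition ricci_coeff :: "'a \<Rightarrow> real" where "ricci_coeff x = (m - 1) * (H x)\<^sup>2 + \<epsilon> * (m - 2 + (\<theta> x)\<^sup>2)"

lemma ricci_M:
  assumes x: "x \<in> U"
  shows "ricci G x v w = ricci_coeff x * G x v w - \<epsilon> * (m - 2) * (t x v * t x w)"
proof -
  interpret G: inner_form "G x" by (rule G_form[OF x])
  have Glin: "linear (\<lambda>u. G x u w)" by (rule G.linear_left)
  have slin: "linear (\<lambda>u. s x u w)"
    unfolding s_def using linear_t[OF x]
    by (intro linearI) (auto simp: linear_add linear_cmul G.form_simps algebra_simps)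
  have sT: "s x (T x) w = (\<theta> x)\<^sup>2 * t x w"
    by (simp add: s_def G_T[OF x] t_T[OF x] algebra_simps)
  have tr: "op_trace (\<lambda>u::'a. c *\<^sub>R u) = c * m" for c
    by (simp add: op_trace_scaleR op_trace_id m)
  have "ricci G x v w = (H x)\<^sup>2 * (G x v w * m - G x v w)
      + \<epsilon> * (s x v w * (m - t x (T x)) - s x (v - t x v *\<^sub>R T x) w)"
    unfolding ricci_def curvature_M[OF x]
    by (simp only: op_trace_add op_trace_diff op_trace_scaleR tr op_trace_id m[symmetric] op_trace_rank_one[OF Glin]
        op_trace_rank_one[OF slin] op_trace_rank_one[OF linear_t[OF x]])
  then show ?thesis
    unfolding linear_diff[OF slin] linear_cmul[OF slin] sT t_T[OF x]
    by (simp add: s_def ricci_coeff_def algebra_simps power2_eq_square)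
qed

lemma ricci_op_M:
  assumes x: "x \<in> U"
  shows "ricci_op G x u = ricci_coeff x *\<^sub>R u - (\<epsilon> * (m - 2) * t x u) *\<^sub>R T x"
  unfolding ricci_op_def
proof (rule inner_form.sharp_eqI[OF G_form[OF x]])
  show "G x (ricci_coeff x *\<^sub>R u - (\<epsilon> * (m - 2) * t x u) *\<^sub>R T x) w = ricci G x u w" for w
    by (simp add: inner_form.form_simps[OF G_form[OF x]] ricci_M[OF x] G_T[OF x])
qed

lemma scal_M:
  assumes x: "x \<in> U"
  shows "scal G x = m * (m - 1) * (H x)\<^sup>2 + \<epsilon> * (m - 1) * (m - 2 + 2 * (\<theta> x)\<^sup>2)"
proof -
  have "ricci_op G x = (\<lambda>u. ricci_coeff x *\<^sub>R u - (\<epsilon> * (m - 2)) *\<^sub>R (t x u *\<^sub>R T x))"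
    by (simp add: ricci_op_M[OF x] fun_eq_iff)
  then have "scal G x = ricci_coeff x * m - \<epsilon> * (m - 2) * t x (T x)"
    unfolding scal_def m
    by (simp only: op_trace_diff op_trace_scaleR op_trace_id op_trace_rank_one[OF linear_t[OF x]])
  then show ?thesis by (simp add: ricci_coeff_def t_T[OF x] algebra_simps power2_eq_square)
qed

text \<open>In the factor \<open>m + 2\<close>, the \<open>m\<close> comes from the derivative of
  \<open>(H x)\<^sup>2\<close> by Codazzi and the 2 from that of
  \<open>(\<theta> x)\<^sup>2\<close>.\<close>

lemma deriv_scal:
  assumes x: "x \<in> U"
  shows "dir_deriv (scal G) x u = - 2 * \<epsilon> * (m - 1) * (m + 2) * \<theta> x * H x * t x u"
proof -
  have "dir_deriv (scal G) x u =
      dir_deriv (\<lambda>y. m * (m - 1) * (H y)\<^sup>2 + \<epsilon> * (m - 1) * (m - 2 + 2 * (\<theta> y)\<^sup>2)) x u"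
    by (rule fun_cong[OF frechet_derivative_cong_open[OF open_dom x scal_M]])
  also have "\<dots> = m * (m - 1) * (- 2 * \<epsilon> * \<theta> x * H x * t x u)
      + \<epsilon> * (m - 1) * (0 + 2 * (of_nat 2 * (- H x * t x u) * \<theta> x ^ (2 - 1)))"
    by (rule dir_deriv_eq, intro has_derivative_add has_derivative_mult_right has_derivative_H_sq[OF x]
        has_derivative_const has_derivative_power deriv_\<theta>[OF x])
  finally show ?thesis by (simp add: algebra_simps)
qed

lemma metric_gradient_scal:
  assumes x: "x \<in> U"
  shows "G x (gradient G (scal G) x) w = - 2 * \<epsilon> * (m - 1) * (m + 2) * \<theta> x * H x * t x w"
proof -
  have "linear (\<lambda>u. - 2 * \<epsilon> * (m - 1) * (m + 2) * \<theta> x * H x * t x u)"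
    using linear_t[OF x] by (intro linearI) (auto simp: linear_add linear_cmul algebra_simps)
  moreover have "dir_deriv (scal G) x = (\<lambda>u. - 2 * \<epsilon> * (m - 1) * (m + 2) * \<theta> x * H x * t x u)"
    using deriv_scal[OF x] by blast
  ultimately show ?thesis
    unfolding gradient_def using inner_form.form_sharp[OF G_form[OF x]] by simp
qed

section \<open>The terms of the conformal bitension field\<close>

lemma trace_second_fform_ricci:
  assumes x: "x \<in> U"
  shows "metric_trace (G x) (\<lambda>u v. second_fform G h f x (ricci_op G x u) v) = (H x * scal G x) *\<^sub>R \<eta> x"
  using inner_form.metric_trace_form[OF G_form[OF x], of "ricci_op G x"]
  by (simp add: second_fform_eq[OF x] metric_trace_scaleR_left metric_trace_mult scal_def)

text \<open>\<open>b\<close> collects the normal terms that carry a factor \<epsilon>; it is left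
  unspecified because the normal equation is evaluated for \<open>\<epsilon> = 0\<close> and the
  tangential one does not see it.\<close>

lemma rough_laplacian_tension:
  assumes x: "x \<in> U"
  obtains b where "- rough_laplacian G h f (tension G h f) x =
      (- m\<^sup>2 * H x ^ 3 - \<epsilon> * b) *\<^sub>R \<eta> x + (3 * m * \<epsilon> * \<theta> x * H x) *\<^sub>R dir_deriv f x (T x)"
proof -
  interpret G: inner_form "G x" by (rule G_form[OF x])
  let ?b = "metric_trace (G x) (\<lambda>u v.
    m * (\<theta> x * snd (dir_deriv2 F x u v) - H x * t x u * t x v - \<theta> x * t x (christoffel G x u v)))"
  have "- rough_laplacian G h f (tension G h f) x = metric_trace (G x) (\<lambda>u v.
      (- \<epsilon> * (m * (\<theta> x * snd (dir_deriv2 F x u v) - H x * t x u * t x v - \<theta> x * t x (christoffel G x u v)))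
      - (m * H x ^ 3) * G x u v) *\<^sub>R \<eta> x
      + (m * \<epsilon> * \<theta> x * H x) *\<^sub>R (t x v *\<^sub>R dir_deriv f x u)
      + (2 * m * \<epsilon> * \<theta> x * H x) *\<^sub>R (t x u *\<^sub>R dir_deriv f x v))"
    unfolding rough_laplacian_def M.cov_deriv_const pull_cov2_tension[OF x]
    by (simp add: mult_ac)
  also have "\<dots> = (- \<epsilon> * ?b - (m * H x ^ 3) * m) *\<^sub>R \<eta> x
      + (m * \<epsilon> * \<theta> x * H x) *\<^sub>R dir_deriv f x (T x) + (2 * m * \<epsilon> * \<theta> x * H x) *\<^sub>R dir_deriv f x (T x)"
    by (simp only: metric_trace_add metric_trace_scaleR metric_trace_scaleR_left metric_trace_diff
        metric_trace_mult G.metric_trace_self m[symmetric] G.metric_trace_right[OF linear_t[OF x] linear_df[OF x]]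
        G.metric_trace_left[OF linear_t[OF x] linear_df[OF x]] T_def)
  also have "\<dots> = (- m\<^sup>2 * H x ^ 3 - \<epsilon> * ?b) *\<^sub>R \<eta> x + (3 * m * \<epsilon> * \<theta> x * H x) *\<^sub>R dir_deriv f x (T x)"
    unfolding add.assoc scaleR_left_distrib[symmetric]
    by (rule arg_cong2[where f="\<lambda>p q. p *\<^sub>R \<eta> x + q *\<^sub>R dir_deriv f x (T x)"])
      (simp_all add: power2_eq_square algebra_simps)
  finally show thesis by (rule that)
qed

lemma trace_curvature_tangential:
  assumes x: "x \<in> U"
  shows "h (f x) (metric_trace (G x) (\<lambda>u v. curvature h (f x) (dir_deriv f x u) (tension G h f x) (dir_deriv f x v)))
    (dir_deriv f x w) = \<epsilon> * m * (m - 1) * H x * \<theta> x * t x w"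
proof -
  interpret G: inner_form "G x" by (rule G_form[OF x])
  have lin: "linear (\<lambda>X. h (f x) X (dir_deriv f x w))"
    by (rule inner_form.linear_left[OF metric_form[OF fx[OF x]]])
  have tau: "slice_form \<epsilon> (dir_deriv \<psi> (f x) (tension G h f x)) (dir_deriv \<psi> (f x) (dir_deriv f x v))
      = - (m * H x * \<theta> x * t x v)" for v
    using slice_normal[OF x, of v]
    by (simp add: tension_eq[OF x] linear_cmul[OF linear_param[OF fx[OF x]]] slice_simps deriv_F[OF x] N_def)
  have fr: "slice_form \<epsilon> (dir_deriv \<psi> (f x) (dir_deriv f x u)) (dir_deriv \<psi> (f x) (dir_deriv f x v)) = s x u v" for u v
    using slice_frame[OF x, of u v] by (simp add: deriv_F[OF x])
  have Gl: "linear (\<lambda>u. G x u w)" by (rule G.linear_left)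
  have mult: "metric_trace (G x) (\<lambda>u v. t x v * L u) = L (T x)" if "linear L" for L :: "'a \<Rightarrow> real"
    using G.metric_trace_right[OF linear_t[OF x] that] by (simp add: T_def)
  have "h (f x) (metric_trace (G x) (\<lambda>u v. curvature h (f x) (dir_deriv f x u) (tension G h f x) (dir_deriv f x v)))
      (dir_deriv f x w) = metric_trace (G x) (\<lambda>u v.
        h (f x) (curvature h (f x) (dir_deriv f x u) (tension G h f x) (dir_deriv f x v)) (dir_deriv f x w))"
    by (rule metric_trace_linear[OF lin])
  \<comment> \<open>Replacing \<open>s\<close> by \<open>G\<close> minus the square of
    \<open>t\<close> produces two cubic terms in \<open>t\<close>, which cancel.\<close>
  also have "\<dots> = metric_trace (G x) (\<lambda>u v. (\<epsilon> * m * H x * \<theta> x) *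
      (t x w * G x u v - t x v * G x u w))"
    unfolding curvature_eq[OF fx[OF x]] tau fr s_def by (simp add: algebra_simps)
  also have "\<dots> = (\<epsilon> * m * H x * \<theta> x) * (t x w * m - G x (T x) w)"
    by (simp only: metric_trace_mult metric_trace_diff G.metric_trace_self m[symmetric] mult[OF Gl])
  finally show ?thesis by (simp add: G_T[OF x] algebra_simps)
qed

lemma trace_curvature_flat:
  assumes x: "x \<in> U" and flat: "\<epsilon> = 0"
  shows "metric_trace (G x) (\<lambda>u v. curvature h (f x) (dir_deriv f x u) (tension G h f x) (dir_deriv f x v)) = 0"
proof -
  have "curvature h (f x) u v w = 0" for u v w
    by (rule inner_form.eqI[OF metric_form[OF fx[OF x]]],
        unfold curvature_eq[OF fx[OF x]] inner_form.form_simps[OF metric_form[OF fx[OF x]]])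
      (simp add: flat)
  then show ?thesis by (simp add: metric_trace_def)
qed

end

section \<open>The two scalar equations and the vanishing of H\<close>

text \<open>An integral root would make \<open>5\<close> divide \<open>4\<close>.\<close>

lemma tangential_coefficient_nonzero:
  fixes n :: nat
  shows "5 * (real n)\<^sup>2 - 10 * real n - 4 \<noteq> 0"
proof
  assume "5 * (real n)\<^sup>2 - 10 * real n - 4 = 0"
  then have "real_of_int (5 * (int n)\<^sup>2 - 10 * int n - 4) = real_of_int 0" by simp
  then have "5 * ((int n)\<^sup>2 - 2 * int n) = 4" by (simp only: of_int_eq_iff) simp
  then show False by presburger
qed

lemma normal_coefficient_pos: "0 < 2 * m\<^sup>2 - 5 * m + (6::real)"
proof -
  have eq: "2 * m\<^sup>2 - 5 * m + 6 = 2 * (m - 5 / 4)\<^sup>2 + 23 / 8" by (simp add: power2_eq_square algebra_simps)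
  show ?thesis unfolding eq by (intro add_nonneg_pos) auto
qed

locale c_biharmonic_umbilical_patch = umbilical_patch +
  assumes c_biharmonic: "x \<in> U \<Longrightarrow> conformal_bitension G h f x = 0"
begin

text \<open>Tangential contributions come from the Laplacian, \<open>3 * m\<close>, from the
  curvature trace, \<open>- m * (m - 1)\<close>, and from the gradient of Scal,
  \<open>- 2 / 3 * (m - 1) * (m + 2)\<close>. Their sum is
  \<open>- (5 * m\<^sup>2 - 10 * m - 4) / 3\<close>.\<close>

lemma tangential_equation:
  assumes x: "x \<in> U"
  shows "\<epsilon> * \<theta> x * H x * t x w = 0"
proof -
  interpret h: inner_form "h (f x)" by (rule metric_form[OF fx[OF x]])
  obtain b where lap: "- rough_laplacian G h f (tension G h f) x =
      (- m\<^sup>2 * H x ^ 3 - \<epsilon> * b) *\<^sub>R \<eta> x + (3 * m * \<epsilon> * \<theta> x * H x) *\<^sub>R dir_deriv f x (T x)"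
    by (rule rough_laplacian_tension[OF x])
  have tan: "h (f x) (dir_deriv f x u) (dir_deriv f x w) = G x u w" for u
    by (simp add: G_eq[OF x])
  have "0 = h (f x) (conformal_bitension G h f x) (dir_deriv f x w)"
    by (simp add: c_biharmonic[OF x] h.form_simps)
  also have "\<dots> = 3 * m * \<epsilon> * \<theta> x * H x * t x w - \<epsilon> * m * (m - 1) * H x * \<theta> x * t x w
      + 1 / 3 * (- 2 * \<epsilon> * (m - 1) * (m + 2) * \<theta> x * H x * t x w)"
    unfolding conformal_bitension_def bitension_def lap trace_second_fform_ricci[OF x]
    unfolding h.form_simps
    unfolding trace_curvature_tangential[OF x]
    unfolding tension_eq[OF x]
    by (simp add: h.form_simps normal_orth[OF x] tan G_T[OF x] metric_gradient_scal[OF x])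
  also have "\<dots> = - (5 * m\<^sup>2 - 10 * m - 4) / 3 * (\<epsilon> * \<theta> x * H x * t x w)"
    by (simp add: power2_eq_square field_simps)
  finally show ?thesis using tangential_coefficient_nonzero[of "DIM('a)"] by (auto simp: m)
qed

text \<open>In flat space the Laplacian, the Scal term and the Ricci term all have multiples of the
  cube of H as normal components; the coefficients add up to \<open>- m / 3\<close> times a
  quadratic of negative discriminant.\<close>

lemma H_zero_flat:
  assumes x: "x \<in> U" and flat: "\<epsilon> = 0"
  shows "H x = 0"
proof -
  interpret h: inner_form "h (f x)" by (rule metric_form[OF fx[OF x]])
  obtain b where lap: "- rough_laplacian G h f (tension G h f) x =
      (- m\<^sup>2 * H x ^ 3 - \<epsilon> * b) *\<^sub>R \<eta> x + (3 * m * \<epsilon> * \<theta> x * H x) *\<^sub>R dir_deriv f x (T x)"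
    by (rule rough_laplacian_tension[OF x])
  have orth: "h (f x) (dir_deriv f x u) (\<eta> x) = 0" for u
    using normal_orth[OF x] by (simp add: h.commute)
  have lap': "- rough_laplacian G h f (tension G h f) x = (- m\<^sup>2 * H x ^ 3) *\<^sub>R \<eta> x"
    using lap by (simp add: flat)
  have sc: "scal G x = m * (m - 1) * (H x)\<^sup>2"
    using scal_M[OF x] by (simp add: flat)
  have "0 = h (f x) (conformal_bitension G h f x) (\<eta> x)"
    by (simp add: c_biharmonic[OF x] h.form_simps)
  also have "\<dots> = - m\<^sup>2 * H x ^ 3 - 2 / 3 * (m * (m - 1) * (H x)\<^sup>2) * (m * H x)
      + 2 * (H x * (m * (m - 1) * (H x)\<^sup>2))"
    unfolding conformal_bitension_def bitension_def lap' trace_second_fform_ricci[OF x]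
      trace_curvature_flat[OF x flat]
    unfolding tension_eq[OF x]
    by (simp add: h.form_simps normal_unit[OF x] orth sc)
  also have "\<dots> = - (m / 3 * (2 * m\<^sup>2 - 5 * m + 6)) * H x ^ 3"
    by (simp add: power2_eq_square power3_eq_cube field_simps)
  finally show ?thesis using normal_coefficient_pos[of m] dim by (auto simp: m)
qed

lemma H_zero_curved:
  assumes x: "x \<in> U" and curved: "\<epsilon> \<noteq> 0"
  shows "H x = 0"
proof (rule ccontr)
  assume Hx: "H x \<noteq> 0"
  interpret G: inner_form "G x" by (rule G_form[OF x])
  have "continuous_on U H"
    using H_differentiable by (auto intro!: continuous_at_imp_continuous_on differentiable_imp_continuous_within)
  \<comment> \<open>On this neighbourhood of \<open>x\<close> the tangential equation can be divided
    by \<epsilon> and H, so \<theta> T vanishes identically there and may be differentiated.\<close>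
  then have O: "open (U \<inter> H -` (- {0}))"
    by (rule continuous_open_preimage[OF _ open_dom]) auto
  have xO: "x \<in> U \<inter> H -` (- {0})" using x Hx by simp
  have van: "\<theta> y * t y w = 0" if "y \<in> U \<inter> H -` (- {0})" for y w
    using tangential_equation[of y w] that curved by auto
  have D: "((\<lambda>y. \<theta> y * t y w) has_derivative
      (\<lambda>u. \<theta> x * snd (dir_deriv2 F x u w) + - H x * t x u * t x w)) (at x)" for w
    by (rule has_derivative_mult[OF deriv_\<theta>[OF x] has_derivative_t[OF x]])
  have D0: "\<theta> x * snd (dir_deriv2 F x u w) = H x * (t x u * t x w)" for u w
    using has_derivative_locally_const[OF D O xO van, of w u] by simp
  \<comment> \<open>The vertical component of the second fundamental form: the Hessian of the height
    function is \<open>H x * \<theta> x\<close> times the metric.\<close>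
  have sndII: "snd (dir_deriv2 F x u w) = t x (christoffel G x u w) + H x * G x u w * \<theta> x" for u w
    using arg_cong[OF normal_part_eq[OF x, of u w], of snd]
    by (simp add: M.normal_part_def t_def \<theta>_def position_def)
  have key: "t x u * t x w = (\<theta> x)\<^sup>2 * G x u w" for u w
  proof -
    have "H x * (t x u * t x w) = \<theta> x * t x (christoffel G x u w) + H x * ((\<theta> x)\<^sup>2 * G x u w)"
      unfolding D0[symmetric] sndII by (simp add: algebra_simps power2_eq_square)
    then show ?thesis using van[OF xO] Hx by simp
  qed
  \<comment> \<open>A nonzero kernel vector of \<open>t x\<close>, found as a Euclidean orthogonal
    to the vector that represents \<open>t x\<close>. Inserting it twice into \<open>key\<close>
    forces \<open>\<theta> x = 0\<close>.\<close>
  obtain w where w: "w \<noteq> 0" "(\<Sum>i\<in>Basis. t x i *\<^sub>R i) \<bullet> w = 0"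
    using orthogonal_to_vector_exists[OF dim] unfolding orthogonal_def by blast
  have "t x w = (\<Sum>i\<in>Basis. t x i *\<^sub>R i) \<bullet> w"
    by (subst linear_basis_expansion[OF linear_t[OF x]]) (simp add: inner_sum_left inner_sum_right inner_commute mult.commute)
  then have "t x w = 0" using w(2) by simp
  then have \<theta>0: "\<theta> x = 0" using key[of w w] G.zero_iff[of w] w(1) by simp
  then have "t x (T x) = 0" using key[of "T x" "T x"] by simp
  then show False using t_T[OF x] \<theta>0 by simp
qed

lemma second_fform_zero:
  assumes x: "x \<in> U"
  shows "second_fform G h f x u v = 0"
proof -
  have "H x = 0" using H_zero_flat[OF x] H_zero_curved[OF x] by blast
  then show ?thesis by (simp add: second_fform_eq[OF x])
qed

end

section \<open>From charts to the manifold\<close>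

lemma chart_inv_chart_map:
  assumes M: "smooth_manifold M" and c: "c \<in> atlas M" and p: "p \<in> chart_dom c"
  shows "chart_inv c (chart_map c p) = p"
proof -
  have "openin (mtop M) (chart_dom c)"
    and "homeomorphic_map (subtopology (mtop M) (chart_dom c))
      (top_of_set (chart_map c ` chart_dom c)) (chart_map c)"
    using M c unfolding smooth_manifold_def by blast+
  then have "inj_on (chart_map c) (chart_dom c)"
    using homeomorphic_imp_injective_map by (metis openin_subset topspace_subtopology_subset)
  then show ?thesis unfolding chart_inv_def using p by (rule inv_into_f_f)
qed

text \<open>The definitions differentiate in the full coordinate space, so local representations can
  be handled by locality arguments only on open sets.\<close>

lemma open_local_dom:
  assumes M: "smooth_manifold M" and c: "c \<in> atlas M"
    and \<phi>: "continuous_map (mtop M) (mtop N) \<phi>" and d: "openin (mtop N) (chart_dom d)"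
  shows "open (local_dom c d \<phi>)"
proof -
  have dom: "openin (mtop M) (chart_dom c)" and img: "open (chart_map c ` chart_dom c)"
    and homeo: "homeomorphic_map (subtopology (mtop M) (chart_dom c))
      (top_of_set (chart_map c ` chart_dom c)) (chart_map c)"
    using M c unfolding smooth_manifold_def by blast+
  have "{p \<in> chart_dom c. \<phi> p \<in> chart_dom d} =
      {p \<in> topspace (mtop M). \<phi> p \<in> chart_dom d} \<inter> chart_dom c"
    using openin_subset[OF dom] by auto
  then have "openin (subtopology (mtop M) (chart_dom c)) {p \<in> chart_dom c. \<phi> p \<in> chart_dom d}"
    unfolding openin_subtopology using openin_continuous_map_preimage[OF \<phi> d] by (intro exI conjI)
  then have "openin (top_of_set (chart_map c ` chart_dom c)) (local_dom c d \<phi>)"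
    using homeomorphic_imp_open_map[OF homeo] unfolding open_map_def local_dom_def by blast
  then show ?thesis by (rule openin_open_trans[OF _ img])
qed

lemma local_dom_subset: "local_dom c d \<phi> \<subseteq> chart_map c ` chart_dom c"
  by (auto simp: local_dom_def)

lemma local_rep_mem:
  assumes "smooth_manifold M" "c \<in> atlas M"
  shows "local_rep c d \<phi> ` local_dom c d \<phi> \<subseteq> chart_map d ` chart_dom d"
  using chart_inv_chart_map[OF assms] by (auto simp: local_rep_def local_dom_def)

theorem theorem1p7:
  fixes M :: "('p, real ^ 'm) rmanifold"
    and \<phi> :: "'p \<Rightarrow> ((real ^ 'm) \<times> real) \<times> real"
    and \<eta> :: "(((real ^ 'm) \<times> real) \<times> real, (real ^ 'm) \<times> real) chart \<Rightarrow> 'p \<Rightarrow> (real ^ 'm) \<times> real"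
    and \<epsilon> :: real
  assumes "CARD('m) \<ge> 2"
    and "\<epsilon> \<in> {-1, 0, 1}"
    and "oriented_hypersurface M (space_form_times_line \<epsilon>) \<phi> \<eta>"
    and "totally_umbilical M (space_form_times_line \<epsilon>) \<phi> \<eta>"
    and "c_biharmonic M (space_form_times_line \<epsilon>) \<phi>"
  shows "totally_geodesic M (space_form_times_line \<epsilon>) \<phi>"
  unfolding totally_geodesic_def
proof (intro ballI allI)
  let ?N = "space_form_times_line \<epsilon> :: (((real ^ 'm) \<times> real) \<times> real, (real ^ 'm) \<times> real) rmanifold"
  fix c d x and u v :: "real ^ 'm"
  assume c: "c \<in> atlas M" and d: "d \<in> atlas ?N" and x: "x \<in> local_dom c d \<phi>"
  let ?U = "local_dom c d \<phi>" and ?f = "local_rep c d \<phi>"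
  have rm: "riemannian_manifold M" and imm: "isometric_immersion M ?N \<phi>"
    and nor: "unit_normal_field M ?N \<phi> \<eta>"
    using assms(3) by (auto simp: oriented_hypersurface_def)
  have sm: "smooth_manifold M" using rm by (simp add: riemannian_manifold_def)
  have map: "smooth_map M ?N \<phi>" using imm by (simp add: isometric_immersion_def)
  have unit: "metric ?N d (?f y) (\<eta> d (chart_inv c y)) (\<eta> d (chart_inv c y)) = 1"
    and orth: "metric ?N d (?f y) (\<eta> d (chart_inv c y)) (dir_deriv ?f y w) = 0" if "y \<in> ?U" for y w
    using nor c d that by (auto simp: unit_normal_field_def Let_def)
  \<comment> \<open>With the mean curvature itself as \<open>H\<close>, the assumption
    \<open>umbilical\<close> is the unfolded hypothesis of total umbilicity.\<close>
  have "c_biharmonic_umbilical_patch \<epsilon> d ?U ?f (\<eta> d \<circ> chart_inv c) (metric M c)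
      (mean_curvature M ?N \<phi> \<eta> c d) (real DIM(real ^ 'm))"
  proof unfold_locales
    show "\<epsilon> \<in> {-1, 0, 1}" "d \<in> atlas ?N" by (fact assms(2) d)+
    show "2 \<le> DIM(real ^ 'm)" using assms(1) by simp
    show "real DIM(real ^ 'm) = real DIM(real ^ 'm)" ..
    have "openin (mtop ?N) (chart_dom d)"
      using d by (auto simp: space_form_times_line_def submanifold_def)
    with map show "open ?U"
      unfolding smooth_map_def by (intro open_local_dom[OF sm c]) auto
    show "smooth_on ?U ?f" using map c d by (simp add: smooth_map_def)
    show "?f ` ?U \<subseteq> chart_map d ` chart_dom d" by (rule local_rep_mem[OF sm c])
    show "smooth_on ?U (\<eta> d \<circ> chart_inv c)"
      using nor c d by (auto simp: unit_normal_field_def section_along_def)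
    fix y assume y: "y \<in> ?U"
    then have "y \<in> chart_map c ` chart_dom c" by (rule subsetD[OF local_dom_subset])
    then show "bilinear (metric M c y)" "metric M c y w z = metric M c y z w"
      "w \<noteq> 0 \<Longrightarrow> 0 < metric M c y w w" for w z
      using rm c unfolding riemannian_manifold_def by blast+
    show "metric M c y w z = metric ?N d (?f y) (dir_deriv ?f y w) (dir_deriv ?f y z)" for w z
      using imm c d y by (auto simp: isometric_immersion_def)
    show "metric ?N d (?f y) ((\<eta> d \<circ> chart_inv c) y) ((\<eta> d \<circ> chart_inv c) y) = 1"
      "metric ?N d (?f y) ((\<eta> d \<circ> chart_inv c) y) (dir_deriv ?f y w) = 0" for w
      using unit[OF y] orth[OF y] by simp_all
    show "sharp (metric M c y)
        (\<lambda>z. - metric ?N d (?f y) (pull_cov (metric ?N d) ?f (\<eta> d \<circ> chart_inv c) y w) (dir_deriv ?f y z)) =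
        mean_curvature M ?N \<phi> \<eta> c d y *\<^sub>R w" for w
      using assms(4) c d y by (simp add: totally_umbilical_def shape_operator_def Let_def)
    show "conformal_bitension (metric M c) (metric ?N d) ?f y = 0"
      using assms(5) c d y by (simp add: c_biharmonic_def)
  qed
  then show "second_fform (metric M c) (metric ?N d) ?f x u v = 0"
    using x by (rule c_biharmonic_umbilical_patch.second_fform_zero)
qed

end
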